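(* There is an absolute constant $c_3$ with the following property. Suppose an RPTree-Max is built using a finite data set $S \subset \mathbb{R}^D$. Pick any cell $C$ in the tree and suppose that $S \cap C$ has doubling dimension at most $d$. Then for any $s \geq 2$, with probability at least $1 - 1/4$ (over the randomization in constructing the subtree rooted at $C$), every descendant $C'$ of $C$ which is more than $c_3 \cdot \log s \cdot d \log (sd)$ levels below $C$ satisfies $\mathrm{radius}(C') \leq \mathrm{radius}(C)/s$.
   Context: Doubling dimension: the doubling dimension of a set $T \subset \mathbb{R}^D$ is the smallest integer $d$ such that for every closed ball $B(x,r) \subset \mathbb{R}^D$, the set $B(x,r) \cap T$ can be covered by $2^d$ balls of radius $r/2$. RPTree-Max: a random binary tree of cells built recursively on a finite data set $S \subset \mathbb{R}^D$; the root cell contains all of $S$. A cell $C$ (containing data $S\cap C$) is split as follows: pick an arbitrary point $x \in S \cap C$ and set $\tilde\Delta = \max\{\|x-y\| : y \in S\cap C\}$; choose a random direction $v \sim N(0,(1/D) I_D)$; independently choose $\delta$ uniformly at random in $[-6\tilde\Delta/\sqrt{D},\, 6\tilde\Delta/\sqrt{D}]$; a point $y \in S \cap C$ goes to the left child if $y\cdot v < \mathrm{median}\{z \cdot v : z \in S \cap C\} + \delta$ and to the right child otherwise. Random choices at different splits are independent. $\mathrm{radius}(C)$ denotes the radius of the cell, i.e. the radius of the smallest ball containing the data $S \cap C$. *)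

theory Defs
  imports "HOL-Probability.Probability" "HOL-Library.Sublist"
begin

text \<open>
  The dimension \<open>D\<close> has to be quantified inside the statement, below the absolute constant, so
  it cannot be a type. Points of Euclidean \<open>D\<close>-space are the extensional functions on \<open>{..<D}\<close>,
  the underlying set of the product measures \<open>PiM {..<D} M\<close> with real factors.
\<close>

abbreviation Rn :: "nat \<Rightarrow> (nat \<Rightarrow> real) set" where
  "Rn D \<equiv> {..<D} \<rightarrow>\<^sub>E UNIV"

definition dot :: "nat \<Rightarrow> (nat \<Rightarrow> real) \<Rightarrow> (nat \<Rightarrow> real) \<Rightarrow> real" where
  "dot D x y = (\<Sum>i<D. x i * y i)"

definition edist_n :: "nat \<Rightarrow> (nat \<Rightarrow> real) \<Rightarrow> (nat \<Rightarrow> real) \<Rightarrow> real" where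
  "edist_n D x y = L2_set (\<lambda>i. x i - y i) {..<D}"

definition closed_ball :: "nat \<Rightarrow> (nat \<Rightarrow> real) \<Rightarrow> real \<Rightarrow> (nat \<Rightarrow> real) set" where
  "closed_ball D c r = {y \<in> Rn D. edist_n D c y \<le> r}"

definition doubling_dim :: "nat \<Rightarrow> (nat \<Rightarrow> real) set \<Rightarrow> nat" where
  "doubling_dim D T = (LEAST d. \<forall>x\<in>Rn D. \<forall>r. \<exists>K\<subseteq>Rn D. finite K \<and> card K \<le> 2 ^ d \<and>
     closed_ball D x r \<inter> T \<subseteq> (\<Union>c\<in>K. closed_ball D c (r / 2)))"

text \<open>For a finite set of data the infimum is attained; it is \<open>0\<close> for the empty set.\<close>

definition radius :: "nat \<Rightarrow> (nat \<Rightarrow> real) set \<Rightarrow> real" where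
  "radius D A = Inf {r. 0 \<le> r \<and> (\<exists>c\<in>Rn D. A \<subseteq> closed_ball D c r)}"

text \<open>
  Median of the family \<open>f z\<close>, \<open>z \<in> A\<close>, counted with multiplicity: the middle value, or the mean of
  the two middle values if \<open>A\<close> has even cardinality.
\<close>

definition median :: "('a \<Rightarrow> real) \<Rightarrow> 'a set \<Rightarrow> real" where
  "median f A = (let xs = sorted_list_of_multiset (image_mset f (mset_set A)); n = length xs
     in (xs ! ((n - 1) div 2) + xs ! (n div 2)) / 2)"

text \<open>
  The randomness used at one split is a pair \<open>(v, u)\<close> with independent \<open>v \<sim> N(0, (1/D) I)\<close>
  and \<open>u\<close> uniform on \<open>[-1, 1]\<close>. The offset \<open>\<delta>\<close> is obtained from \<open>u\<close> by scaling
  (see \<open>distr_uniform_scale\<close> below), because its range depends on the data in the cell.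
\<close>

type_synonym draw = "(nat \<Rightarrow> real) \<times> real"

definition draw_measure :: "nat \<Rightarrow> draw measure" where
  "draw_measure D =
     PiM {..<D} (\<lambda>_. density lborel (normal_density 0 (1 / sqrt (real D))))
       \<Otimes>\<^sub>M uniform_measure lborel {-1..1}"

text \<open>
  Nodes of the infinite binary tree are addressed by their path read from the node up to the root:
  the root is \<open>[]\<close>, the left and right child of \<open>p\<close> are \<open>True # p\<close> and \<open>False # p\<close>, and the
  descendants of \<open>p\<close> that are \<open>k\<close> levels below \<open>p\<close> are the \<open>q @ p\<close> with \<open>length q = k\<close>.
\<close>

type_synonym node = "bool list"

definition tree_measure :: "nat \<Rightarrow> (node \<Rightarrow> draw) measure" where
  "tree_measure D = PiM UNIV (\<lambda>_. draw_measure D)"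

definition goes_left :: "nat \<Rightarrow> (nat \<Rightarrow> real) set \<Rightarrow> (nat \<Rightarrow> real) \<Rightarrow> draw \<Rightarrow> (nat \<Rightarrow> real) \<Rightarrow> bool" where
  "goes_left D A x = (\<lambda>(v, u) y.
     let \<Delta> = Max ((\<lambda>z. edist_n D x z) ` A);
         \<delta> = u * (6 * \<Delta> / sqrt (real D))
     in dot D y v < median (\<lambda>z. dot D z v) A + \<delta>)"

text \<open>
  \<open>pick p \<omega>\<close> is the arbitrary point chosen at node \<open>p\<close>, and \<open>cell D S pick \<omega> p\<close> is the data in the
  cell at node \<open>p\<close>. There is no stopping rule; an empty cell only has empty descendants.
\<close>

type_synonym pick_rule = "node \<Rightarrow> (node \<Rightarrow> draw) \<Rightarrow> (nat \<Rightarrow> real)"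

primrec cell :: "nat \<Rightarrow> (nat \<Rightarrow> real) set \<Rightarrow> pick_rule \<Rightarrow> (node \<Rightarrow> draw) \<Rightarrow> node \<Rightarrow> (nat \<Rightarrow> real) set" where
  "cell D S pick \<omega> [] = S"
| "cell D S pick \<omega> (b # p) =
     {y \<in> cell D S pick \<omega> p. goes_left D (cell D S pick \<omega> p) (pick p \<omega>) (\<omega> p) y \<longleftrightarrow> b}"

text \<open>
  The choice at a node may depend, measurably, on everything drawn at its proper ancestors, but not
  on the draws at the node itself or at later nodes.
\<close>

definition valid_pick :: "nat \<Rightarrow> (nat \<Rightarrow> real) set \<Rightarrow> pick_rule \<Rightarrow> bool" where
  "valid_pick D S pick \<longleftrightarrow>
     (\<forall>p. \<forall>\<omega>\<in>space (tree_measure D).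
        cell D S pick \<omega> p \<noteq> {} \<longrightarrow> pick p \<omega> \<in> cell D S pick \<omega> p) \<and>
     (\<forall>p. \<forall>\<omega>\<in>space (tree_measure D). \<forall>\<omega>'\<in>space (tree_measure D).
        (\<forall>p'. strict_suffix p' p \<longrightarrow> \<omega> p' = \<omega>' p') \<longrightarrow> pick p \<omega> = pick p \<omega>') \<and>
     (\<forall>p. pick p \<in> measurable (tree_measure D) (count_space UNIV))"

text \<open>Redraw the randomness in the subtree rooted at \<open>p\<close>, keeping the rest of the tree.\<close>

definition resample :: "node \<Rightarrow> (node \<Rightarrow> draw) \<Rightarrow> (node \<Rightarrow> draw) \<Rightarrow> (node \<Rightarrow> draw)" where
  "resample p \<omega>\<^sub>0 \<omega> = override_on \<omega>\<^sub>0 \<omega> {q. suffix p q}"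

lemma prob_space_draw_measure:
  assumes "0 < D"
  shows "prob_space (draw_measure D)"
proof -
  interpret N: prob_space "density lborel (normal_density 0 (1 / sqrt (real D)))"
    using assms by (intro prob_space_normal_density) simp
  interpret P: product_prob_space
    "\<lambda>_::nat. density lborel (normal_density 0 (1 / sqrt (real D)))" "{..<D}" ..
  interpret U: prob_space "uniform_measure lborel {-1..1::real}"
    by (rule prob_space_uniform_measure) auto
  interpret pair_prob_space
    "PiM {..<D} (\<lambda>_. density lborel (normal_density 0 (1 / sqrt (real D))))"
    "uniform_measure lborel {-1..1::real}" ..
  show ?thesis
    unfolding draw_measure_def by (rule prob_space_axioms)
qed

lemma prob_space_tree_measure:
  assumes "0 < D"
  shows "prob_space (tree_measure D)"
  unfolding tree_measure_def by (intro prob_space_PiM prob_space_draw_measure assms)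

lemma distr_uniform_scale:
  fixes a :: real
  assumes a: "0 < a"
  shows "distr (uniform_measure lborel {-1..1}) borel (\<lambda>u. u * a) = uniform_measure lborel {-a..a}"
proof (rule measure_eqI)
  fix X :: "real set"
  assume "X \<in> sets (distr (uniform_measure lborel {-1..1}) borel (\<lambda>u. u * a))"
  then have X[measurable]: "X \<in> sets borel" by simp
  have V: "(\<lambda>u. u * a) -` X \<in> sets borel"
    using measurable_sets[of "\<lambda>u. u * a" borel borel X] X by simp
  have eq: "{-1..1} \<inter> (\<lambda>u. u * a) -` X = (\<lambda>u. a * u) -` ({-a..a} \<inter> X)"
  proof -
    have "- 1 \<le> u \<longleftrightarrow> - a \<le> a * u" "u \<le> 1 \<longleftrightarrow> a * u \<le> a" for u
      using mult_le_cancel_left_pos[OF a, of "- 1" u] mult_le_cancel_left_pos[OF a, of u 1] by simp_all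
    then show ?thesis by (auto simp: mult.commute)
  qed
  have "emeasure lborel ({-a..a} \<inter> X) =
      emeasure (density (distr lborel borel ((*) a)) (\<lambda>_. ennreal \<bar>a\<bar>)) ({-a..a} \<inter> X)"
    using lborel_distr_mult'[of a] a by simp
  also have "\<dots> = ennreal a * emeasure lborel ((\<lambda>u. a * u) -` ({-a..a} \<inter> X))"
    using a by (simp add: emeasure_density_const emeasure_distr)
  finally have scale: "emeasure lborel ({-a..a} \<inter> X) =
      ennreal a * emeasure lborel ({-1..1} \<inter> (\<lambda>u. u * a) -` X)"
    unfolding eq .
  have len: "emeasure lborel {-a..a} = ennreal a * 2"
    using a by (simp add: ennreal_mult' mult.commute flip: ennreal_numeral)
  have cancel: "ennreal a * (inverse (ennreal a) * m) = m" for m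
    using a by (simp add: ennreal_divide_self flip: mult.assoc divide_ennreal_def)
  have "emeasure lborel ({-a..a} \<inter> X) / emeasure lborel {-a..a} =
      emeasure lborel ({-1..1} \<inter> (\<lambda>u. u * a) -` X) / 2"
    unfolding scale len using a
    by (simp add: divide_ennreal_def ennreal_inverse_mult cancel mult.assoc mult.commute mult.left_commute)
  then show "emeasure (distr (uniform_measure lborel {-1..1}) borel (\<lambda>u. u * a)) X =
      emeasure (uniform_measure lborel {-a..a}) X"
    using V a scale by (simp add: emeasure_distr)
qed simp

text \<open>
  The \<open>LEAST\<close> in \<open>doubling_dim\<close> is over a nonempty set, so \<open>doubling_dim D T \<le> d\<close> has the expected
  meaning.
\<close>

lemma doubling_dim_le_iff:
  assumes T: "finite T" "T \<subseteq> Rn D"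
  shows "doubling_dim D T \<le> d \<longleftrightarrow>
    (\<forall>x\<in>Rn D. \<forall>r. \<exists>K\<subseteq>Rn D. finite K \<and> card K \<le> 2 ^ d \<and>
       closed_ball D x r \<inter> T \<subseteq> (\<Union>c\<in>K. closed_ball D c (r / 2)))" (is "_ \<longleftrightarrow> ?P d")
proof
  have "?P (card T)"
  proof (intro ballI allI)
    fix x r assume "x \<in> Rn D"
    have "closed_ball D x r \<inter> T \<subseteq> (\<Union>c\<in>T. closed_ball D c (r / 2))"
    proof
      fix y assume y: "y \<in> closed_ball D x r \<inter> T"
      have "0 \<le> edist_n D x y" by (simp add: edist_n_def L2_set_nonneg)
      with y have "0 \<le> r" by (simp add: closed_ball_def)
      with y T have "y \<in> closed_ball D y (r / 2)"
        by (auto simp: closed_ball_def edist_n_def L2_set_def)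
      with y show "y \<in> (\<Union>c\<in>T. closed_ball D c (r / 2))" by blast
    qed
    then show "\<exists>K\<subseteq>Rn D. finite K \<and> card K \<le> 2 ^ card T \<and>
       closed_ball D x r \<inter> T \<subseteq> (\<Union>c\<in>K. closed_ball D c (r / 2))"
      using T less_exp[of "card T"] by (intro exI[of _ T]) auto
  qed
  then have least: "?P (doubling_dim D T)"
    unfolding doubling_dim_def by (rule LeastI)
  assume "doubling_dim D T \<le> d"
  then have "(2::nat) ^ doubling_dim D T \<le> 2 ^ d" by simp
  with least show "?P d" by (meson le_trans)
next
  assume "?P d"
  then show "doubling_dim D T \<le> d"
    unfolding doubling_dim_def by (rule Least_le)
qed

end

theory Submission
  imports Defs
begin

text \<open>
  Fix two balls of radius \<open>r\<close> whose centres are at a distance \<open>l\<close> much larger than \<open>d * r\<close>. A random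
  split separates the two balls with probability of order \<open>l / \<Delta>\<close>, where \<open>\<Delta>\<close> is the largest distance
  from the chosen point, whereas both balls are cut with probability of order \<open>d * r / \<Delta>\<close> only:
  by chaining, the projection of the part of the data lying in a ball of radius \<open>r\<close> has expected width
  \<open>O(d * r / sqrt D)\<close>. Hence the expected number of cells at a given depth that meet both balls never
  increases with the depth, and below a cell of radius at most \<open>4 * l\<close> it decays geometrically.

  If a deep cell is still large, then along its path there is a stage of \<open>n\<close> levels in which the
  radius fails to halve, so the cell at the end of the stage meets two balls at a distance comparable
  with the radius at its beginning. It remains to cover the root cell by \<open>(s * d) ^ O(d)\<close> balls of radius
  of order \<open>radius / (s * d)\<close> and to take the union over all stages and all pairs of balls; expected
  numbers of cells, rather than a union over cells, keep the number of levels per stage at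
  \<open>O(d * ln (s * d))\<close>.
\<close>

subsection \<open>Gaussian projections\<close>

text \<open>For a fixed direction, the number of children meeting both balls is at most 1, plus the
  indicator that the threshold cuts both balls, minus the indicator that it separates them. The
  threshold is uniform in an interval of half-length h = 6 \<Delta> / sqrt D about the median. Hence
  separation has probability (projected gap) / (2 h), up to the widths of the balls, provided both
  projections lie in that interval. This proviso is the obstacle: it may fail for exactly the
  directions with a large gap. A second-moment bound charges those directions at most 2/3 of l /
  sqrt D, whereas the mean gap is sqrt (2 / pi) > 2/3 times l / sqrt D; the 6 of the splitting rule
  is where the 2/3 comes from.

  Expected counts contain the branching already. The factor per level is only 1 - 1/1600, which
  could never absorb a union over 2^n cells; a stage just has to beat the number of pairs of balls.
  As the expected count is at most 1 at the start of every stage, late stages cost no more than the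
  first one.\<close>

definition gauss :: "nat \<Rightarrow> (nat \<Rightarrow> real) measure" where
  "gauss D = PiM {..<D} (\<lambda>_. density lborel (normal_density 0 (1 / sqrt (real D))))"

lemma prob_space_gauss: "0 < D \<Longrightarrow> prob_space (gauss D)"
  unfolding gauss_def by (intro prob_space_PiM prob_space_normal_density) simp

lemma sets_gauss: "sets (gauss D) = sets (PiM {..<D} (\<lambda>_. borel))"
  unfolding gauss_def by (intro sets_PiM_cong) simp_all

lemma measurable_dot_gauss [measurable]: "dot D w \<in> borel_measurable (gauss D)"
proof -
  have "(\<lambda>v. \<Sum>i<D. w i * v i) \<in> borel_measurable (PiM {..<D} (\<lambda>_. borel))"
    by measurable
  then show ?thesis
    unfolding dot_def using measurable_cong_sets[OF sets_gauss refl] by blast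
qed

lemma coordinate_distributed_gauss:
  assumes "0 < D" "i < D"
  shows "distributed (gauss D) lborel (\<lambda>v. v i) (normal_density 0 (1 / sqrt (real D)))"
proof -
  let ?N = "density lborel (\<lambda>x. ennreal (normal_density 0 (1 / sqrt (real D)) x))"
  have "distr (gauss D) ?N (\<lambda>v. v i) = ?N"
    unfolding gauss_def using assms
    by (intro distr_PiM_component prob_space_normal_density) auto
  moreover have "distr (gauss D) ?N (\<lambda>v. v i) = distr (gauss D) lborel (\<lambda>v. v i)"
    by (rule distr_cong) simp_all
  moreover have "(\<lambda>v. v i) \<in> measurable (gauss D) lborel"
    unfolding measurable_cong_sets[OF sets_gauss refl] using assms by simp
  ultimately show ?thesis unfolding distributed_def by simp
qed

text \<open>The tuple of all coordinates is the identity map on \<open>gauss D\<close>, whose law is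
  the product of its marginals; this characterises independence.\<close>

lemma indep_vars_coordinates_gauss:
  assumes "0 < D"
  shows "prob_space.indep_vars (gauss D) (\<lambda>_. borel) (\<lambda>i v. v i) {..<D}"
proof -
  interpret prob_space "gauss D" using assms by (rule prob_space_gauss)
  let ?N = "density lborel (\<lambda>x. ennreal (normal_density 0 (1 / sqrt (real D)) x))"
  have rv: "(\<lambda>v. v i) \<in> measurable (gauss D) borel" if "i \<in> {..<D}" for i
    unfolding measurable_cong_sets[OF sets_gauss refl] using that by simp
  have marg: "distr (gauss D) borel (\<lambda>v. v i) = ?N" if "i \<in> {..<D}" for i
  proof -
    have "distr (gauss D) ?N (\<lambda>v. v i) = ?N"
      unfolding gauss_def using that assms
      by (intro distr_PiM_component prob_space_normal_density) auto
    moreover have "distr (gauss D) ?N (\<lambda>v. v i) = distr (gauss D) borel (\<lambda>v. v i)"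
      by (rule distr_cong) simp_all
    ultimately show ?thesis by simp
  qed
  have "distr (gauss D) (PiM {..<D} (\<lambda>_. borel)) (\<lambda>v. \<lambda>i\<in>{..<D}. v i) = distr (gauss D) (gauss D) (\<lambda>v. v)"
  proof (rule distr_cong)
    fix v assume "v \<in> space (gauss D)"
    then show "(\<lambda>i\<in>{..<D}. v i) = v"
      by (simp add: gauss_def space_PiM PiE_def extensional_restrict)
  qed (simp_all add: sets_gauss)
  also have "\<dots> = gauss D" by simp
  also have "\<dots> = PiM {..<D} (\<lambda>i. distr (gauss D) borel (\<lambda>v. v i))"
    unfolding gauss_def[of D] using marg[unfolded gauss_def] by (intro PiM_cong) simp_all
  finally show ?thesis
    using assms rv by (subst indep_vars_iff_distr_eq_PiM') auto
qed

lemma dot_distributed_gauss: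
  assumes D: "0 < D" and w: "L2_set w {..<D} \<noteq> 0"
  shows "distributed (gauss D) lborel (dot D w) (normal_density 0 (L2_set w {..<D} / sqrt (real D)))"
proof -
  interpret prob_space "gauss D" using D by (rule prob_space_gauss)
  \<comment> \<open>A coordinate of weight 0 has a degenerate law without density, so it is dropped
    before normal variables are added; a nonzero norm keeps \<open>I\<close> nonempty.\<close>
  define I where "I = {i. i < D \<and> w i \<noteq> 0}"
  have I: "finite I" "I \<noteq> {}" "I \<subseteq> {..<D}"
    using w L2_set_eq_0_iff[of "{..<D}" w] by (auto simp: I_def)
  have ind: "indep_vars (\<lambda>_. borel) (\<lambda>i v. w i * v i) I"
    by (rule indep_vars_compose2[OF indep_vars_subset[OF indep_vars_coordinates_gauss[OF D] I(3)],
        where Y = "\<lambda>i x. w i * x"]) measurable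
  have nd: "distributed (gauss D) lborel (\<lambda>v. w i * v i) (normal_density 0 (\<bar>w i\<bar> * (1 / sqrt (real D))))"
    if "i \<in> I" for i
    using normal_density_affine[OF coordinate_distributed_gauss[OF D], of i "w i" 0] that D
    by (auto simp: I_def)
  have "distributed (gauss D) lborel (\<lambda>v. \<Sum>i\<in>I. w i * v i)
     (normal_density (\<Sum>i\<in>I. 0) (sqrt (\<Sum>i\<in>I. (\<bar>w i\<bar> * (1 / sqrt (real D)))\<^sup>2)))"
    using I ind nd D by (intro sum_indep_normal) (auto simp: I_def)
  moreover have "(\<Sum>i\<in>I. w i * v i) = dot D w v" for v
    unfolding dot_def by (rule sum.mono_neutral_left) (auto simp: I_def)
  moreover have "sqrt (\<Sum>i\<in>I. (\<bar>w i\<bar> * (1 / sqrt (real D)))\<^sup>2) = L2_set w {..<D} / sqrt (real D)"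
  proof -
    have "(\<Sum>i\<in>I. (\<bar>w i\<bar> * (1 / sqrt (real D)))\<^sup>2) = (\<Sum>i<D. (w i)\<^sup>2 / real D)"
      using D by (intro sum.mono_neutral_cong_left) (auto simp: I_def power_mult_distrib power_divide)
    then show ?thesis
      by (simp add: L2_set_def real_sqrt_divide flip: sum_divide_distrib)
  qed
  ultimately show ?thesis by simp
qed

lemma dot_eq_0_if_L2_set_eq_0: "L2_set w {..<D} = 0 \<Longrightarrow> dot D w v = 0"
  by (simp add: dot_def L2_set_eq_0_iff)

lemma
  assumes D: "0 < D"
  shows integrable_abs_dot_gauss [simp]: "integrable (gauss D) (\<lambda>v. \<bar>dot D w v\<bar>)" (is ?A)
    and integral_abs_dot_gauss: "(\<integral>v. \<bar>dot D w v\<bar> \<partial>gauss D) = sqrt (2 / pi) * (L2_set w {..<D} / sqrt (real D))" (is ?B)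
    and integrable_dot_sq_gauss [simp]: "integrable (gauss D) (\<lambda>v. (dot D w v)\<^sup>2)" (is ?C)
    and integral_dot_sq_gauss: "(\<integral>v. (dot D w v)\<^sup>2 \<partial>gauss D) = (L2_set w {..<D})\<^sup>2 / real D" (is ?E)
proof -
  interpret prob_space "gauss D" using D by (rule prob_space_gauss)
  have *: "?A \<and> ?B \<and> ?C \<and> ?E"
  proof (cases "L2_set w {..<D} = 0")
    case True
    then have "dot D w = (\<lambda>_. 0)" by (intro ext dot_eq_0_if_L2_set_eq_0)
    with True show ?thesis by simp
  next
    case False
    define \<sigma> where "\<sigma> = L2_set w {..<D} / sqrt (real D)"
    have "0 < L2_set w {..<D}" using False L2_set_nonneg[of w "{..<D}"] by linarith
    with D have \<sigma>: "0 < \<sigma>" by (simp add: \<sigma>_def)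
    note dd = dot_distributed_gauss[OF D False, folded \<sigma>_def]
    have 1: "has_bochner_integral lborel (\<lambda>x. normal_density 0 \<sigma> x * \<bar>x\<bar>) (\<sigma> * sqrt (2 / pi))"
      using normal_moment_abs_odd[OF \<sigma>, of 0 0] by simp
    have 2: "has_bochner_integral lborel (\<lambda>x. normal_density 0 \<sigma> x * x\<^sup>2) (\<sigma>\<^sup>2)"
      using normal_moment_even[OF \<sigma>, of 0 1] by (simp add: eval_nat_numeral)
    have A: ?A
      using distributed_integrable[OF dd, of abs] 1[THEN integrable.intros] by simp
    have B: ?B
      using distributed_integral[OF dd, of abs] 1[THEN has_bochner_integral_integral_eq]
      by (simp add: \<sigma>_def mult.commute)
    have C: ?C
      using distributed_integrable[OF dd, of "\<lambda>x. x\<^sup>2"] 2[THEN integrable.intros] by simp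
    have E: ?E
      using distributed_integral[OF dd, of "\<lambda>x. x\<^sup>2"] 2[THEN has_bochner_integral_integral_eq]
      by (simp add: \<sigma>_def power_divide)
    show ?thesis by (rule conjI[OF A conjI[OF B conjI[OF C E]]])
  qed
  show ?A using * by (elim conjE)
  show ?B using * by (elim conjE)
  show ?C using * by (elim conjE)
  show ?E using * by (elim conjE)
qed

text \<open>Completing the square turns the integrand into a multiple of the normal density with
  mean t * \<sigma>^2.\<close>

lemma
  assumes \<sigma>: "0 < \<sigma>"
  shows integrable_normal_density_exp: "integrable lborel (\<lambda>x. normal_density 0 \<sigma> x * exp (t * x))"
    and integral_normal_density_exp: "(\<integral>x. normal_density 0 \<sigma> x * exp (t * x) \<partial>lborel) = exp (t\<^sup>2 * \<sigma>\<^sup>2 / 2)"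
proof -
  have "- x\<^sup>2 / (2 * \<sigma>\<^sup>2) + t * x = t\<^sup>2 * \<sigma>\<^sup>2 / 2 + - (x - t * \<sigma>\<^sup>2)\<^sup>2 / (2 * \<sigma>\<^sup>2)" for x
    using \<sigma> by (simp add: field_simps power2_eq_square)
  then have "exp (- x\<^sup>2 / (2 * \<sigma>\<^sup>2)) * exp (t * x) =
      exp (t\<^sup>2 * \<sigma>\<^sup>2 / 2) * exp (- (x - t * \<sigma>\<^sup>2)\<^sup>2 / (2 * \<sigma>\<^sup>2))" for x
    by (simp only: exp_add[symmetric])
  then have "normal_density 0 \<sigma> x * exp (t * x) = exp (t\<^sup>2 * \<sigma>\<^sup>2 / 2) * normal_density (t * \<sigma>\<^sup>2) \<sigma> x" for x
    unfolding normal_density_def by simp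
  then show "integrable lborel (\<lambda>x. normal_density 0 \<sigma> x * exp (t * x))"
    "(\<integral>x. normal_density 0 \<sigma> x * exp (t * x) \<partial>lborel) = exp (t\<^sup>2 * \<sigma>\<^sup>2 / 2)"
    using \<sigma> by simp_all
qed

text \<open>exp (t * |x|) is at most exp (t * x) + exp (- t * x), and the restriction on
  \<open>t\<close> makes t times the standard deviation at most 1. One constant then serves all
  links of a chain.\<close>

lemma
  assumes D: "0 < D" and t: "0 \<le> t" "t * L2_set w {..<D} \<le> sqrt (real D)"
  shows integrable_exp_abs_dot_gauss: "integrable (gauss D) (\<lambda>v. exp (t * \<bar>dot D w v\<bar>))" (is ?A)
    and integral_exp_abs_dot_gauss_le: "(\<integral>v. exp (t * \<bar>dot D w v\<bar>) \<partial>gauss D) \<le> 2 * exp (1 / 2)" (is ?B)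
proof -
  interpret prob_space "gauss D" using D by (rule prob_space_gauss)
  have *: "?A \<and> ?B"
  proof (cases "L2_set w {..<D} = 0")
    case True
    have "(1::real) \<le> 2 * exp (1 / 2)" using one_le_exp_iff[of "1/2::real"] by linarith
    with True show ?thesis by (simp add: dot_eq_0_if_L2_set_eq_0 prob_space)
  next
    case False
    define \<sigma> where "\<sigma> = L2_set w {..<D} / sqrt (real D)"
    have "0 < L2_set w {..<D}" using False L2_set_nonneg[of w "{..<D}"] by linarith
    with D have \<sigma>: "0 < \<sigma>" by (simp add: \<sigma>_def)
    note dd = dot_distributed_gauss[OF D False, folded \<sigma>_def]
    have int: "integrable (gauss D) (\<lambda>v. exp (c * dot D w v))"
      "(\<integral>v. exp (c * dot D w v) \<partial>gauss D) = exp (c\<^sup>2 * \<sigma>\<^sup>2 / 2)" for c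
      using distributed_integrable[OF dd, of "\<lambda>x. exp (c * x)"] distributed_integral[OF dd, of "\<lambda>x. exp (c * x)"]
        integrable_normal_density_exp[OF \<sigma>, of c] integral_normal_density_exp[OF \<sigma>, of c] by simp_all
    have le: "exp (t * \<bar>dot D w v\<bar>) \<le> exp (t * dot D w v) + exp ((- t) * dot D w v)" for v
      by (cases "0 \<le> dot D w v") auto
    have A: ?A
      by (rule Bochner_Integration.integrable_bound[OF Bochner_Integration.integrable_add[OF int(1)[of t] int(1)[of "- t"]]])
         (use le in \<open>auto simp: abs_of_pos add_pos_pos\<close>)
    have "(\<integral>v. exp (t * \<bar>dot D w v\<bar>) \<partial>gauss D) \<le> (\<integral>v. exp (t * dot D w v) + exp ((- t) * dot D w v) \<partial>gauss D)"
      by (rule integral_mono[OF A Bochner_Integration.integrable_add[OF int(1)[of t] int(1)[of "- t"]] le])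
    also have "\<dots> = 2 * exp (t\<^sup>2 * \<sigma>\<^sup>2 / 2)"
      using int[of t] int[of "- t"] by (subst Bochner_Integration.integral_add) simp_all
    also have "\<dots> \<le> 2 * exp (1 / 2)"
    proof -
      have "t * \<sigma> \<le> 1" using t D by (simp add: \<sigma>_def field_simps)
      then have "(t * \<sigma>)\<^sup>2 \<le> 1" using t \<sigma> by (simp add: power_le_one)
      then show ?thesis by (simp add: power_mult_distrib)
    qed
    finally show ?thesis using A by simp
  qed
  show ?A using * by (elim conjE)
  show ?B using * by (elim conjE)
qed

subsection \<open>Chaining in a doubling set\<close>

lemma edist_n_nonneg [simp]: "0 \<le> edist_n D x y"
  by (simp add: edist_n_def L2_set_nonneg)

lemma edist_n_refl [simp]: "edist_n D x x = 0"
  by (simp add: edist_n_def L2_set_def)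

lemma edist_n_commute: "edist_n D x y = edist_n D y x"
  by (simp add: edist_n_def L2_set_def power2_commute)

lemma edist_n_triangle: "edist_n D x z \<le> edist_n D x y + edist_n D y z"
  using L2_set_triangle_ineq[of "\<lambda>i. x i - y i" "\<lambda>i. y i - z i" "{..<D}"]
  by (simp add: edist_n_def)

lemma dot_diff: "dot D (\<lambda>i. x i - y i) v = dot D x v - dot D y v"
  by (simp add: dot_def left_diff_distrib sum_subtractf)

text \<open>The condition under the \<open>LEAST\<close> of \<open>doubling_dim\<close>; as a
  predicate it passes to subsets at once, hence to every descendant cell.\<close>

definition doubling :: "nat \<Rightarrow> nat \<Rightarrow> (nat \<Rightarrow> real) set \<Rightarrow> bool" where
  "doubling D d T \<longleftrightarrow> (\<forall>x\<in>Rn D. \<forall>r. \<exists>K\<subseteq>Rn D. finite K \<and> card K \<le> 2 ^ d \<and>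
     closed_ball D x r \<inter> T \<subseteq> (\<Union>c\<in>K. closed_ball D c (r / 2)))"

lemma doubling_mono: "doubling D d T \<Longrightarrow> A \<subseteq> T \<Longrightarrow> doubling D d A"
  unfolding doubling_def by (meson Int_mono order_refl order_trans)

text \<open>Every ball of a cover is halved in turn, which multiplies the number of balls by 2^d.
  The centres stay in \<open>Rn D\<close>, so that doubling applies to them again.\<close>

lemma doubling_cover:
  assumes T: "doubling D d T" and x: "x \<in> Rn D"
  shows "\<exists>K\<subseteq>Rn D. finite K \<and> card K \<le> 2 ^ (d * m) \<and>
     closed_ball D x r \<inter> T \<subseteq> (\<Union>c\<in>K. closed_ball D c (r / 2 ^ m))"
proof (induction m)
  case 0
  show ?case using x by (intro exI[of _ "{x}"]) auto
next
  case (Suc m)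
  then obtain K where K: "K \<subseteq> Rn D" "finite K" "card K \<le> 2 ^ (d * m)"
    "closed_ball D x r \<inter> T \<subseteq> (\<Union>c\<in>K. closed_ball D c (r / 2 ^ m))" by blast
  have "\<exists>L. L \<subseteq> Rn D \<and> finite L \<and> card L \<le> 2 ^ d \<and>
      closed_ball D c (r / 2 ^ m) \<inter> T \<subseteq> (\<Union>e\<in>L. closed_ball D e (r / 2 ^ m / 2))" if "c \<in> K" for c
    using T K(1) that unfolding doubling_def by blast
  then obtain L where L: "\<And>c. c \<in> K \<Longrightarrow> L c \<subseteq> Rn D" "\<And>c. c \<in> K \<Longrightarrow> finite (L c)"
    "\<And>c. c \<in> K \<Longrightarrow> card (L c) \<le> 2 ^ d"
    "\<And>c. c \<in> K \<Longrightarrow> closed_ball D c (r / 2 ^ m) \<inter> T \<subseteq> (\<Union>e\<in>L c. closed_ball D e (r / 2 ^ m / 2))"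
    by metis
  let ?L = "\<Union>c\<in>K. L c"
  have "card ?L \<le> (\<Sum>c\<in>K. card (L c))"
    by (rule card_UN_le[OF K(2)])
  also have "\<dots> \<le> card K * 2 ^ d"
    using sum_bounded_above[of K "\<lambda>c. card (L c)" "2 ^ d"] L(3) by simp
  also have "\<dots> \<le> 2 ^ (d * Suc m)"
    using K(3) by (simp add: power_add)
  finally have "card ?L \<le> 2 ^ (d * Suc m)" .
  moreover have "closed_ball D x r \<inter> T \<subseteq> (\<Union>c\<in>?L. closed_ball D c (r / 2 ^ Suc m))"
  proof
    fix y assume y: "y \<in> closed_ball D x r \<inter> T"
    then obtain c where "c \<in> K" "y \<in> closed_ball D c (r / 2 ^ m) \<inter> T" using K(4) by blast
    with L(4) obtain e where "e \<in> L c" "y \<in> closed_ball D e (r / 2 ^ m / 2)" by blast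
    with \<open>c \<in> K\<close> show "y \<in> (\<Union>c\<in>?L. closed_ball D c (r / 2 ^ Suc m))"
      by (auto simp: mult.commute)
  qed
  ultimately show ?case
    using K(2) L(1,2) by (intro exI[of _ ?L]) auto
qed

text \<open>The total cost of a chain: level j has about 2^(d * (2 * j + 1)) links, whose logarithm
  is weighted by the mesh 2^-j. Only the bound 6 is used.\<close>

lemma sum_odd_over_power2: "(\<Sum>j<J. (2 * real j + 1) / 2 ^ j) = 6 - (4 * real J + 6) / 2 ^ J"
proof (induction J)
  case (Suc J)
  have "(2 * real J + 1) / 2 ^ J - (4 * real J + 6) / 2 ^ J = - ((4 * real (Suc J) + 6) / 2 ^ Suc J)"
    by (simp add: field_simps)
  with Suc show ?case by simp
qed simp

text \<open>The logarithm is replaced by its tangent at \<open>M\<close>. The bound becomes affine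
  in \<open>S\<close>, so an expectation can be taken directly; with \<open>M\<close> at least the
  mean of \<open>S\<close> it gives ln M / t.\<close>

lemma le_log_sum_exp:
  fixes x :: real
  assumes "0 < t" "0 < M" "exp (t * x) \<le> S"
  shows "x \<le> (ln M - 1 + S / M) / t"
proof -
  have "t * x - ln M = ln (exp (t * x) / M)" using assms by (simp add: ln_div)
  also have "\<dots> \<le> exp (t * x) / M - 1" using assms by (intro ln_le_minus_one) simp
  also have "\<dots> \<le> S / M - 1" using assms by (simp add: divide_right_mono)
  finally show ?thesis using assms by (simp add: field_simps)
qed

text \<open>
  Chaining: \<open>y - c\<close> is a sum of links between consecutive nets of mesh \<open>r / 2 ^ j\<close>. There are at most
  \<open>2 ^ (d * (2 * j + 1))\<close> links of length \<open>O(r / 2 ^ j)\<close> at level \<open>j\<close>, and \<open>le_log_sum_exp\<close>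
  bounds all of them simultaneously. The last term of the chain is summed over all of \<open>A\<close>.
\<close>

lemma chaining_bound:
  assumes D: "0 < D" and d: "1 \<le> d" and A: "finite A" "A \<subseteq> Rn D" "doubling D d A"
    and c: "c \<in> Rn D" and r: "0 < r"
  obtains Z where "integrable (gauss D) Z"
    "\<And>v y. y \<in> A \<Longrightarrow> edist_n D c y \<le> r \<Longrightarrow> \<bar>dot D y v - dot D c v\<bar> \<le> Z v"
    "(\<integral>v. Z v \<partial>gauss D) \<le> 19 * real d * r / sqrt (real D)"
proof -
  interpret prob_space "gauss D" using D by (rule prob_space_gauss)
  define B where "B = A \<inter> closed_ball D c r"
  have finB: "finite B" using A by (simp add: B_def)
  have "\<exists>K\<subseteq>Rn D. finite K \<and> card K \<le> 2 ^ (d * j) \<and> B \<subseteq> (\<Union>c\<in>K. closed_ball D c (r / 2 ^ j))" for j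
    using doubling_cover[OF A(3) c, of j r] unfolding B_def by (simp add: Int_commute)
  then obtain K' where K': "\<And>j. finite (K' j)" "\<And>j. card (K' j) \<le> 2 ^ (d * j)"
    "\<And>j. B \<subseteq> (\<Union>c\<in>K' j. closed_ball D c (r / 2 ^ j))" by metis
  \<comment> \<open>Level 0 is the centre alone, so that every chain starts exactly at
    \<open>c\<close>.\<close>
  define K where "K j = (if j = 0 then {c} else K' j)" for j :: nat
  have K: "finite (K j)" "card (K j) \<le> 2 ^ (d * j)" for j
    using K' by (simp_all add: K_def)
  have near: "\<exists>k. k \<in> K j \<and> edist_n D k y \<le> r / 2 ^ j" if "y \<in> B" for j y
    using K'(3)[of j] that by (cases "j = 0") (auto simp: K_def B_def closed_ball_def)
  define \<pi> where "\<pi> j y = (SOME k. k \<in> K j \<and> edist_n D k y \<le> r / 2 ^ j)" for j y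
  have \<pi>: "\<pi> j y \<in> K j" "edist_n D (\<pi> j y) y \<le> r / 2 ^ j" if "y \<in> B" for j y
    using someI_ex[OF near[OF that, of j], folded \<pi>_def] by simp_all
  have \<pi>0: "\<pi> 0 y = c" if "y \<in> B" for y
    using \<pi>(1)[OF that, of 0] by (simp add: K_def)
  \<comment> \<open>Consecutive approximations of one point are at distance at most r / 2^j + r /
    2^(j + 1).\<close>
  define \<rho> where "\<rho> j = 3 / 2 * (r / 2 ^ j)" for j :: nat
  have \<rho>: "0 < \<rho> j" for j using r by (simp add: \<rho>_def)
  define L where "L j = {(k, k'). k \<in> K j \<and> k' \<in> K (Suc j) \<and> edist_n D k k' \<le> \<rho> j}" for j
  have L: "finite (L j)" "card (L j) \<le> 2 ^ (d * (2 * j + 1))" for j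
  proof -
    have sub: "L j \<subseteq> K j \<times> K (Suc j)" by (auto simp: L_def)
    have fin: "finite (K j \<times> K (Suc j))" using K(1) by simp
    show "finite (L j)" using finite_subset[OF sub fin] .
    have "card (L j) \<le> card (K j) * card (K (Suc j))"
      using card_mono[OF fin sub] by (simp add: card_cartesian_product)
    also have "\<dots> \<le> 2 ^ (d * j) * 2 ^ (d * Suc j)" by (intro mult_le_mono K)
    also have "\<dots> = 2 ^ (d * j + d * Suc j)" by (simp only: power_add)
    also have "d * j + d * Suc j = d * (2 * j + 1)" unfolding Suc_eq_plus1 by algebra
    finally show "card (L j) \<le> 2 ^ (d * (2 * j + 1))" .
  qed
  define t where "t j = sqrt (real D) / \<rho> j" for j
  have t: "0 < t j" for j using \<rho> D by (simp add: t_def)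
  \<comment> \<open>An upper bound for the mean of \<open>S j\<close>: the number of links times the
    exponential moment of one link.\<close>
  define M where "M j = 2 ^ (d * (2 * j + 1)) * (2 * exp (1 / 2 :: real))" for j :: nat
  have M: "0 < M j" for j by (simp add: M_def)
  define S where "S j v = (\<Sum>(k, k')\<in>L j. exp (t j * \<bar>dot D (\<lambda>i. k' i - k i) v\<bar>))" for j v
  \<comment> \<open>Enough levels for the crude sum over \<open>B\<close> at the end of the chain:
    \<open>card B\<close> is below 2^J, which cancels the final mesh r / 2^J.\<close>
  define J where "J = card A"
  define R where "R v = (\<Sum>y\<in>B. \<bar>dot D (\<lambda>i. y i - \<pi> J y i) v\<bar>)" for v
  define Z where "Z v = (\<Sum>j<J. (ln (M j) - 1 + S j v / M j) / t j) + R v" for v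
  have len: "t j * L2_set (\<lambda>i. k' i - k i) {..<D} \<le> sqrt (real D)" if "(k, k') \<in> L j" for j k k'
  proof -
    have "L2_set (\<lambda>i. k' i - k i) {..<D} = edist_n D k k'"
      unfolding edist_n_commute[of D k] by (simp add: edist_n_def)
    then have "L2_set (\<lambda>i. k' i - k i) {..<D} \<le> \<rho> j" using that by (simp add: L_def)
    then have "t j * L2_set (\<lambda>i. k' i - k i) {..<D} \<le> t j * \<rho> j"
      using t[of j] by (intro mult_left_mono) simp_all
    also have "\<dots> = sqrt (real D)" using \<rho>[of j] by (simp add: t_def)
    finally show ?thesis .
  qed
  note exp_int = integrable_exp_abs_dot_gauss[OF D less_imp_le[OF t] len]
    integral_exp_abs_dot_gauss_le[OF D less_imp_le[OF t] len]
  have S_int: "integrable (gauss D) (S j)" for j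
    unfolding S_def by (intro Bochner_Integration.integrable_sum) (auto intro: exp_int)
  have S_le: "(\<integral>v. S j v \<partial>gauss D) \<le> M j" for j
  proof -
    have "(\<integral>v. S j v \<partial>gauss D) = (\<Sum>(k, k')\<in>L j. \<integral>v. exp (t j * \<bar>dot D (\<lambda>i. k' i - k i) v\<bar>) \<partial>gauss D)"
      unfolding S_def using exp_int(1)[of _ _ j]
      by (subst Bochner_Integration.integral_sum) (auto intro!: sum.cong simp: case_prod_unfold)
    also have "\<dots> \<le> real (card (L j)) * (2 * exp (1 / 2))"
      using exp_int(2)[of _ _ j] by (intro sum_bounded_above) auto
    also have "\<dots> \<le> 2 ^ (d * (2 * j + 1)) * (2 * exp (1 / 2))"
    proof (intro mult_right_mono)
      show "real (card (L j)) \<le> 2 ^ (d * (2 * j + 1))"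
        using L(2)[of j] by (metis of_nat_le_iff of_nat_numeral of_nat_power)
    qed simp
    finally show ?thesis by (simp add: M_def)
  qed
  have R_int: "integrable (gauss D) R"
    unfolding R_def using D by simp
  have R_le: "(\<integral>v. R v \<partial>gauss D) \<le> r / sqrt (real D)"
  proof -
    have "(\<integral>v. R v \<partial>gauss D) = (\<Sum>y\<in>B. sqrt (2 / pi) * (edist_n D y (\<pi> J y) / sqrt (real D)))"
      unfolding R_def using D
      by (subst Bochner_Integration.integral_sum) (simp_all add: integral_abs_dot_gauss edist_n_def)
    also have "\<dots> \<le> real (card B) * (1 * (r / 2 ^ J / sqrt (real D)))"
    proof (intro sum_bounded_above mult_mono divide_right_mono)
      show "sqrt (2 / pi) \<le> 1" using pi_gt3 by simp
      show "edist_n D y (\<pi> J y) \<le> r / 2 ^ J" if "y \<in> B" for y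
        using \<pi>(2)[OF that] by (simp add: edist_n_commute)
    qed (use D in simp_all)
    also have "\<dots> \<le> 2 ^ J * (1 * (r / 2 ^ J / sqrt (real D)))"
    proof (intro mult_right_mono)
      have "card B \<le> J" unfolding J_def B_def using A by (simp add: card_mono)
      also have "J < 2 ^ J" by (rule less_exp)
      finally show "real (card B) \<le> 2 ^ J"
        by (metis less_imp_le of_nat_le_iff of_nat_numeral of_nat_power)
    qed (use r in simp)
    finally show ?thesis by simp
  qed
  have ln_M: "ln (M j) / t j \<le> 3 * real d * r / sqrt (real D) * ((2 * real j + 1) / 2 ^ j)" for j
  proof -
    have "ln (M j) = real (d * (2 * j + 1)) * ln 2 + (ln 2 + 1 / 2)"
      by (simp add: M_def ln_mult ln_realpow)
    also have "\<dots> \<le> real (d * (2 * j + 1)) * (7 / 10) + 13 / 10 * real (d * (2 * j + 1))"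
    proof (intro add_mono mult_left_mono)
      show ln2: "ln 2 \<le> 7 / (10::real)" using ln2_le_25_over_36 by linarith
      have "1 \<le> d * (2 * j + 1)" using d by simp
      then have "1 \<le> real (d * (2 * j + 1))" by linarith
      then show "ln 2 + 1 / 2 \<le> 13 / 10 * real (d * (2 * j + 1))" using ln2 by linarith
    qed simp
    also have "\<dots> = 2 * real d * (2 * real j + 1)" by (simp add: field_simps)
    finally have "ln (M j) \<le> 2 * real d * (2 * real j + 1)" .
    then have "ln (M j) / t j \<le> 2 * real d * (2 * real j + 1) / t j"
      using t[of j] by (intro divide_right_mono) simp_all
    also have "\<dots> = 3 * real d * r / sqrt (real D) * ((2 * real j + 1) / 2 ^ j)"
      using r D by (simp add: t_def \<rho>_def field_simps)
    finally show ?thesis .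
  qed
  show ?thesis
  proof (rule that[of Z])
    show "integrable (gauss D) Z"
      unfolding Z_def using S_int R_int by simp
    show "\<bar>dot D y v - dot D c v\<bar> \<le> Z v" if y: "y \<in> A" "edist_n D c y \<le> r" for v y
    proof -
      have yB: "y \<in> B" using y A by (auto simp: B_def closed_ball_def)
      have link: "(\<pi> j y, \<pi> (Suc j) y) \<in> L j" for j
      proof -
        have "edist_n D (\<pi> j y) (\<pi> (Suc j) y) \<le> r / 2 ^ j + r / 2 ^ Suc j"
          using edist_n_triangle[of D "\<pi> j y" "\<pi> (Suc j) y" y] \<pi>(2)[OF yB, of j]
            \<pi>(2)[OF yB, of "Suc j"] by (simp add: edist_n_commute)
        then show ?thesis using \<pi>(1)[OF yB] by (simp add: L_def \<rho>_def)
      qed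
      have step: "\<bar>dot D (\<pi> (Suc j) y) v - dot D (\<pi> j y) v\<bar> \<le> (ln (M j) - 1 + S j v / M j) / t j" for j
      proof (rule le_log_sum_exp[OF t M])
        show "exp (t j * \<bar>dot D (\<pi> (Suc j) y) v - dot D (\<pi> j y) v\<bar>) \<le> S j v"
          using member_le_sum[of "(\<pi> j y, \<pi> (Suc j) y)" "L j"
              "\<lambda>(k, k'). exp (t j * \<bar>dot D (\<lambda>i. k' i - k i) v\<bar>)"] link[of j] L(1)
          by (auto simp: S_def dot_diff)
      qed
      have res: "\<bar>dot D y v - dot D (\<pi> J y) v\<bar> \<le> R v"
        using member_le_sum[of y B "\<lambda>y. \<bar>dot D (\<lambda>i. y i - \<pi> J y i) v\<bar>"] yB finB
        by (auto simp: R_def dot_diff)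
      have "dot D y v - dot D c v =
          (\<Sum>j<J. dot D (\<pi> (Suc j) y) v - dot D (\<pi> j y) v) + (dot D y v - dot D (\<pi> J y) v)"
        using sum_lessThan_telescope[of "\<lambda>j. dot D (\<pi> j y) v" J] by (simp add: \<pi>0[OF yB])
      then have "\<bar>dot D y v - dot D c v\<bar> \<le>
          \<bar>\<Sum>j<J. dot D (\<pi> (Suc j) y) v - dot D (\<pi> j y) v\<bar> + \<bar>dot D y v - dot D (\<pi> J y) v\<bar>"
        by linarith
      also have "\<dots> \<le> (\<Sum>j<J. \<bar>dot D (\<pi> (Suc j) y) v - dot D (\<pi> j y) v\<bar>) + \<bar>dot D y v - dot D (\<pi> J y) v\<bar>"
        by (intro add_right_mono sum_abs)
      also have "\<dots> \<le> Z v"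
        unfolding Z_def by (intro add_mono sum_mono step res)
      finally show ?thesis .
    qed
    have "(\<integral>v. Z v \<partial>gauss D) =
        (\<Sum>j<J. (ln (M j) - 1 + (\<integral>v. S j v \<partial>gauss D) / M j) / t j) + (\<integral>v. R v \<partial>gauss D)"
      unfolding Z_def using S_int R_int by (simp add: prob_space)
    also have "\<dots> \<le> (\<Sum>j<J. ln (M j) / t j) + r / sqrt (real D)"
    proof (intro add_mono sum_mono divide_right_mono R_le)
      show "ln (M j) - 1 + (\<integral>v. S j v \<partial>gauss D) / M j \<le> ln (M j)" for j
        using S_le[of j] M[of j] by simp
      show "0 \<le> t j" for j using t[of j] by simp
    qed
    also have "\<dots> \<le> 3 * real d * r / sqrt (real D) * (\<Sum>j<J. (2 * real j + 1) / 2 ^ j) + r / sqrt (real D)"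
      unfolding sum_distrib_left by (intro add_mono sum_mono ln_M order_refl)
    \<comment> \<open>19 = 3 * 6 + 1: the links give 3 * 6, with 3 = 2 * 3/2 from
      \<open>ln_M\<close>, and the end of the chain gives 1.\<close>
    also have "\<dots> \<le> 3 * real d * r / sqrt (real D) * 6 + real d * r / sqrt (real D)"
    proof (intro add_mono mult_left_mono divide_right_mono)
      show "r \<le> real d * r" using d r by simp
    qed (use r in \<open>simp_all add: sum_odd_over_power2\<close>)
    also have "\<dots> = 19 * real d * r / sqrt (real D)" by (simp add: field_simps)
    finally show "(\<integral>v. Z v \<partial>gauss D) \<le> 19 * real d * r / sqrt (real D)" .
  qed
qed

subsection \<open>The median and a uniform threshold\<close>

text \<open>On a sorted list a downward closed predicate holds exactly on an initial segment. A
  general predicate covers strict and weak upper bounds, both of which the median needs.\<close>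

lemma sorted_nth_iff_less_length_filter:
  assumes "sorted xs" "k < length xs" "\<And>x y. x \<le> y \<Longrightarrow> P y \<Longrightarrow> P x"
  shows "P (xs ! k) \<longleftrightarrow> k < length (filter P xs)"
  using assms(1,2)
proof (induction xs arbitrary: k)
  case (Cons x xs)
  show ?case
  proof (cases "P x")
    case True
    with Cons show ?thesis by (cases k) auto
  next
    case False
    have none: "\<not> P y" if "y \<in> set (x # xs)" for y
      using False Cons.prems(1) that assms(3)[of x y] by auto
    then have "filter P (x # xs) = []" by (simp add: filter_empty_conv)
    moreover have "\<not> P ((x # xs) ! k)" using none nth_mem[OF Cons.prems(2)] by blast
    ultimately show ?thesis by simp
  qed
qed simp

definition order_stat :: "('a \<Rightarrow> real) \<Rightarrow> 'a set \<Rightarrow> nat \<Rightarrow> real" where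
  "order_stat f A k = sorted_list_of_multiset (image_mset f (mset_set A)) ! k"

lemma length_sorted_list_of_image [simp]:
  "length (sorted_list_of_multiset (image_mset f (mset_set A))) = card A"
  by (metis mset_sorted_list_of_multiset size_image_mset size_mset size_mset_set)

lemma order_stat_iff:
  assumes A: "finite A" "k < card A" and P: "\<And>x y. x \<le> y \<Longrightarrow> P y \<Longrightarrow> P x"
  shows "P (order_stat f A k) \<longleftrightarrow> k < card {z \<in> A. P (f z)}"
proof -
  let ?xs = "sorted_list_of_multiset (image_mset f (mset_set A))"
  have "length (filter P ?xs) = size (filter_mset P (mset ?xs))"
    by (metis mset_filter size_mset)
  also have "\<dots> = size (filter_mset (\<lambda>z. P (f z)) (mset_set A))"
    by (simp add: filter_mset_image_mset)
  also have "\<dots> = card {z \<in> A. P (f z)}"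
    using A(1) by simp
  finally show ?thesis
    unfolding order_stat_def using A(2) P by (subst sorted_nth_iff_less_length_filter) auto
qed

lemma median_eq_order_stat:
  "median f A = (order_stat f A ((card A - 1) div 2) + order_stat f A (card A div 2)) / 2"
  by (simp add: median_def order_stat_def Let_def)

text \<open>The sublevel set at \<open>a\<close> consists of the points where more than
  \<open>k\<close> of the values are at most \<open>a\<close>, a condition on a finite sum of
  indicators.\<close>

lemma measurable_order_stat:
  assumes A: "finite A" "k < card A" and f: "\<And>z. z \<in> A \<Longrightarrow> (\<lambda>w. f w z) \<in> borel_measurable M"
  shows "(\<lambda>w. order_stat (f w) A k) \<in> borel_measurable M"
proof (subst borel_measurable_iff_le, rule allI)
  fix a :: real
  have card_eq: "real (card {z \<in> A. f w z \<le> a}) = (\<Sum>z\<in>A. if f w z \<le> a then 1 else 0)" for w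
    using A(1) by (simp add: sum.If_cases Int_def)
  have "order_stat (f w) A k \<le> a \<longleftrightarrow> real k < (\<Sum>z\<in>A. if f w z \<le> a then 1 else 0)" for w
    unfolding card_eq[symmetric] of_nat_less_iff by (rule order_stat_iff[OF A]) simp
  then have "{w \<in> space M. order_stat (f w) A k \<le> a} =
      {w \<in> space M. real k < (\<Sum>z\<in>A. if f w z \<le> a then 1 else 0)}" by blast
  also have "\<dots> \<in> sets M"
    using f by measurable
  finally show "{w \<in> space M. order_stat (f w) A k \<le> a} \<in> sets M" .
qed

lemma measurable_median:
  assumes "finite A" "\<And>z. z \<in> A \<Longrightarrow> (\<lambda>w. f w z) \<in> borel_measurable M"
  shows "(\<lambda>w. median (f w) A) \<in> borel_measurable M"
proof (cases "A = {}")
  case True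
  then show ?thesis by (simp add: median_def)
next
  case False
  then have "0 < card A" using assms(1) by (simp add: card_gt_0_iff)
  then show ?thesis
    unfolding median_eq_order_stat using assms
    by (intro borel_measurable_divide borel_measurable_add measurable_order_stat) auto
qed

text \<open>A median above \<mu> + T forces the upper middle value above it, and a median below
  \<mu> - T the lower one below; either way half of the data is far from \<mu>. Thus second moments
  of the data control the median.\<close>

lemma card_far_from_median:
  assumes A: "finite A" "A \<noteq> {}" and far: "T < \<bar>median f A - \<mu>\<bar>"
  shows "card A \<le> 2 * card {z \<in> A. T \<le> \<bar>f z - \<mu>\<bar>}"
proof -
  let ?n = "card A"
  have n: "0 < ?n" using A by (simp add: card_gt_0_iff)
  have mono: "order_stat f A ((?n - 1) div 2) \<le> order_stat f A (?n div 2)"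
    unfolding order_stat_def using n by (intro sorted_nth_mono) (auto simp: div_le_mono)
  have "\<mu> + T < order_stat f A (?n div 2)" if "\<not> order_stat f A ((?n - 1) div 2) < \<mu> - T"
  proof -
    have "T < median f A - \<mu> \<or> T < \<mu> - median f A" using far by linarith
    with that mono show ?thesis unfolding median_eq_order_stat by (elim disjE) (simp_all add: field_simps)
  qed
  then consider "\<mu> + T < order_stat f A (?n div 2)" | "order_stat f A ((?n - 1) div 2) < \<mu> - T"
    by blast
  then show ?thesis
  proof cases
    case 1
    then have "card {z \<in> A. f z \<le> \<mu> + T} \<le> ?n div 2"
      using order_stat_iff[of A "?n div 2" "\<lambda>x. x \<le> \<mu> + T" f] A n by auto
    moreover have "?n = card {z \<in> A. f z \<le> \<mu> + T} + card {z \<in> A. \<not> f z \<le> \<mu> + T}"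
      using A(1) by (subst card_Un_disjoint[symmetric]) (auto intro: arg_cong[where f = card])
    moreover have "card {z \<in> A. \<not> f z \<le> \<mu> + T} \<le> card {z \<in> A. T \<le> \<bar>f z - \<mu>\<bar>}"
      using A(1) by (intro card_mono) auto
    ultimately show ?thesis by linarith
  next
    case 2
    then have "(?n - 1) div 2 < card {z \<in> A. f z < \<mu> - T}"
      using order_stat_iff[of A "(?n - 1) div 2" "\<lambda>x. x < \<mu> - T" f] A n by auto
    moreover have "card {z \<in> A. f z < \<mu> - T} \<le> card {z \<in> A. T \<le> \<bar>f z - \<mu>\<bar>}"
      using A(1) by (intro card_mono) auto
    ultimately show ?thesis by linarith
  qed
qed

lemma measure_uniform_affine:
  assumes h: "0 < h" and ab: "\<alpha> \<le> \<beta>"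
  shows "measure (uniform_measure lborel {-1..1}) {u. \<alpha> \<le> m + u * h \<and> m + u * h \<le> \<beta>} \<le> (\<beta> - \<alpha>) / (2 * h)"
    and "m - h \<le> \<alpha> \<Longrightarrow> \<beta> \<le> m + h \<Longrightarrow>
      measure (uniform_measure lborel {-1..1}) {u. \<alpha> < m + u * h \<and> m + u * h \<le> \<beta>} = (\<beta> - \<alpha>) / (2 * h)"
proof -
  let ?a = "(\<alpha> - m) / h" and ?b = "(\<beta> - m) / h"
  have le: "?a \<le> ?b" using h ab by (simp add: divide_right_mono)
  have 1: "{u. \<alpha> \<le> m + u * h \<and> m + u * h \<le> \<beta>} = {?a..?b}"
    using h by (auto simp: field_simps)
  have 2: "{u. \<alpha> < m + u * h \<and> m + u * h \<le> \<beta>} = {?a<..?b}"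
    using h by (auto simp: field_simps)
  have "measure lborel ({-1..1} \<inter> {?a..?b}) \<le> measure lborel {?a..?b}"
    by (intro measure_mono_fmeasurable) (auto intro!: fmeasurableI simp: emeasure_lborel_Icc_eq)
  then show "measure (uniform_measure lborel {-1..1}) {u. \<alpha> \<le> m + u * h \<and> m + u * h \<le> \<beta>} \<le> (\<beta> - \<alpha>) / (2 * h)"
    unfolding 1 using le h by (simp add: field_simps)
  assume "m - h \<le> \<alpha>" "\<beta> \<le> m + h"
  then have "-1 \<le> ?a" "?b \<le> 1" using h by (simp_all add: field_simps)
  then have "{-1..1} \<inter> {?a<..?b} = {?a<..?b}" by auto
  then show "measure (uniform_measure lborel {-1..1}) {u. \<alpha> < m + u * h \<and> m + u * h \<le> \<beta>} = (\<beta> - \<alpha>) / (2 * h)"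
    unfolding 2 using le h by (simp add: field_simps)
qed

lemma prob_space_uniform: "prob_space (uniform_measure lborel {-1..1::real})"
  by (rule prob_space_uniform_measure) auto

text \<open>The two events have total measure that of their union plus that of their intersection.
  On the intersection the threshold cuts \<open>A\<close>, so it lies in an interval of length 2 *
  z; the union misses all thresholds that separate \<open>A\<close> from \<open>B\<close>.\<close>

lemma split_uniform_threshold:
  fixes f :: "'a \<Rightarrow> real"
  assumes h: "0 < h" and A: "finite A" "A \<noteq> {}" and B: "finite B" "B \<noteq> {}"
    and f: "\<And>y. y \<in> A \<Longrightarrow> \<bar>f y - \<alpha>\<bar> \<le> z" "\<And>y. y \<in> B \<Longrightarrow> \<bar>f y - \<beta>\<bar> \<le> w"
  shows "measure (uniform_measure lborel {-1..1}) {u. (\<exists>y\<in>A. f y < m + u * h) \<and> (\<exists>y\<in>B. f y < m + u * h)}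
     + measure (uniform_measure lborel {-1..1}) {u. (\<exists>y\<in>A. \<not> f y < m + u * h) \<and> (\<exists>y\<in>B. \<not> f y < m + u * h)}
     \<le> 1 + z / h - (if \<bar>\<alpha> - m\<bar> \<le> h \<and> \<bar>\<beta> - m\<bar> \<le> h then (\<bar>\<alpha> - \<beta>\<bar> - z - w) / (2 * h) else 0)"
proof -
  let ?U = "uniform_measure lborel {-1..1::real}"
  interpret prob_space ?U by (rule prob_space_uniform)
  define L where "L = {u. (\<exists>y\<in>A. f y < m + u * h) \<and> (\<exists>y\<in>B. f y < m + u * h)}"
  define R where "R = {u. (\<exists>y\<in>A. \<not> f y < m + u * h) \<and> (\<exists>y\<in>B. \<not> f y < m + u * h)}"
  have [measurable]: "L \<in> sets borel" "R \<in> sets borel"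
    unfolding L_def R_def using A B by measurable
  have z: "0 \<le> z" "0 \<le> w" using f A(2) B(2) by force+
  have LR: "measure ?U L + measure ?U R = measure ?U (L \<union> R) + measure ?U (L \<inter> R)"
  proof -
    have "L \<in> fmeasurable ?U" "R \<in> fmeasurable ?U" by (simp_all add: fmeasurable_eq_sets)
    from measure_Un3[OF this] show ?thesis by linarith
  qed
  have "L \<inter> R \<subseteq> {u. \<alpha> - z \<le> m + u * h \<and> m + u * h \<le> \<alpha> + z}"
  proof
    fix u assume "u \<in> L \<inter> R"
    then obtain y y' where "y \<in> A" "f y < m + u * h" "y' \<in> A" "\<not> f y' < m + u * h"
      by (auto simp: L_def R_def)
    with f(1)[of y] f(1)[of y'] show "u \<in> {u. \<alpha> - z \<le> m + u * h \<and> m + u * h \<le> \<alpha> + z}" by auto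
  qed
  then have "measure ?U (L \<inter> R) \<le> measure ?U {u. \<alpha> - z \<le> m + u * h \<and> m + u * h \<le> \<alpha> + z}"
    by (intro finite_measure_mono) auto
  also have "\<dots> \<le> z / h"
    using measure_uniform_affine(1)[OF h, of "\<alpha> - z" "\<alpha> + z" m] z by simp
  finally have both: "measure ?U (L \<inter> R) \<le> z / h" .
  have "measure ?U (L \<union> R) \<le> 1 - (if \<bar>\<alpha> - m\<bar> \<le> h \<and> \<bar>\<beta> - m\<bar> \<le> h then (\<bar>\<alpha> - \<beta>\<bar> - z - w) / (2 * h) else 0)"
  \<comment> \<open>When the widths exceed the gap, the claimed gain is negative and the trivial
    bound 1 suffices.\<close>
  proof (cases "\<bar>\<alpha> - m\<bar> \<le> h \<and> \<bar>\<beta> - m\<bar> \<le> h \<and> z + w \<le> \<bar>\<alpha> - \<beta>\<bar>")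
    case True
    define a b where "a = (if \<alpha> \<le> \<beta> then \<alpha> + z else \<beta> + w)"
      and "b = (if \<alpha> \<le> \<beta> then \<beta> - w else \<alpha> - z)"
    \<comment> \<open>Open below and closed above, matching the strict test of
      \<open>goes_left\<close>: for these thresholds one set goes left as a whole and the other one
      right.\<close>
    let ?S = "{u. a < m + u * h \<and> m + u * h \<le> b}"
    have [measurable]: "?S \<in> sets borel" by measurable
    have "(L \<union> R) \<inter> ?S = {}"
    proof -
      have False if u: "u \<in> L \<union> R" "u \<in> ?S" for u
      proof (cases "\<alpha> \<le> \<beta>")
        case True
        then have "f y < m + u * h" if "y \<in> A" for y
          using u(2) f(1)[OF that] by (auto simp: a_def)
        moreover have "\<not> f y < m + u * h" if "y \<in> B" for y
          using True u(2) f(2)[OF that] by (auto simp: b_def)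
        ultimately show False using u(1) by (auto simp: L_def R_def)
      next
        case False
        then have "f y < m + u * h" if "y \<in> B" for y
          using u(2) f(2)[OF that] by (auto simp: a_def)
        moreover have "\<not> f y < m + u * h" if "y \<in> A" for y
          using False u(2) f(1)[OF that] by (auto simp: b_def)
        ultimately show False using u(1) by (auto simp: L_def R_def)
      qed
      then show ?thesis by blast
    qed
    then have "measure ?U (L \<union> R) + measure ?U ?S = measure ?U ((L \<union> R) \<union> ?S)"
      by (intro finite_measure_Union[symmetric]) auto
    also have "\<dots> \<le> 1" by (rule prob_le_1)
    finally have le: "measure ?U (L \<union> R) + measure ?U ?S \<le> 1" .
    have S: "measure ?U ?S = (b - a) / (2 * h)"
      using True z by (intro measure_uniform_affine(2)[OF h]) (auto simp: a_def b_def abs_if split: if_splits)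
    have ba: "b - a = \<bar>\<alpha> - \<beta>\<bar> - z - w" by (auto simp: a_def b_def)
    from le[unfolded S ba] True show ?thesis by (simp del: measure_uniform_measure)
  next
    case False
    have "(\<bar>\<alpha> - \<beta>\<bar> - z - w) / (2 * h) \<le> 0" if "\<not> z + w \<le> \<bar>\<alpha> - \<beta>\<bar>"
      using that h by (intro divide_nonpos_pos) auto
    with False show ?thesis by (intro order_trans[OF prob_le_1]) auto
  qed
  with LR both show ?thesis unfolding L_def R_def by linarith
qed

subsection \<open>A single split\<close>

lemma draw_measure_eq: "draw_measure D = gauss D \<Otimes>\<^sub>M uniform_measure lborel {-1..1}"
  by (simp add: draw_measure_def gauss_def)

lemma goes_left_iff:
  "goes_left D A x w y \<longleftrightarrow> dot D y (fst w) < median (\<lambda>z. dot D z (fst w)) A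
     + snd w * (6 * Max ((\<lambda>z. edist_n D x z) ` A) / sqrt (real D))"
  by (simp add: goes_left_def Let_def case_prod_unfold)

lemma measurable_goes_left [measurable]:
  assumes "finite A"
  shows "Measurable.pred (draw_measure D) (\<lambda>w. goes_left D A x w y)"
proof -
  have [measurable]: "(\<lambda>w. dot D z (fst w)) \<in> borel_measurable (draw_measure D)" for z
    unfolding draw_measure_eq by (rule measurable_compose[OF measurable_fst measurable_dot_gauss])
  have [measurable]: "(\<lambda>w. snd w) \<in> borel_measurable (draw_measure D)"
    unfolding draw_measure_eq
    using measurable_snd[of "gauss D" "uniform_measure lborel {-1..1::real}"]
    by (simp add: measurable_cong_sets[OF refl sets_uniform_measure])
  have [measurable]: "(\<lambda>w. median (\<lambda>z. dot D z (fst w)) A) \<in> borel_measurable (draw_measure D)"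
    by (rule measurable_median[OF assms]) measurable
  show ?thesis unfolding goes_left_iff by measurable
qed

lemma
  assumes D: "0 < D" and Q: "{w \<in> space (draw_measure D). Q w} \<in> sets (draw_measure D)"
  shows integrable_draw_measure_section:
      "integrable (gauss D) (\<lambda>v. measure (uniform_measure lborel {-1..1}) {u. Q (v, u)})" (is ?A)
    and measure_draw_measure_eq: "measure (draw_measure D) {w \<in> space (draw_measure D). Q w} =
      (\<integral>v. measure (uniform_measure lborel {-1..1}) {u. Q (v, u)} \<partial>gauss D)" (is ?B)
proof -
  let ?U = "uniform_measure lborel {-1..1::real}"
  let ?Q = "{w \<in> space (draw_measure D). Q w}"
  interpret G: prob_space "gauss D" using D by (rule prob_space_gauss)
  interpret U: prob_space ?U by (rule prob_space_uniform)
  interpret P: pair_prob_space "gauss D" ?U ..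
  have int: "integrable (gauss D \<Otimes>\<^sub>M ?U) (indicat_real ?Q)"
    using Q unfolding draw_measure_eq by (simp add: less_top[symmetric])
  have sec: "(\<integral>u. indicat_real ?Q (v, u) \<partial>?U) = measure ?U {u. Q (v, u)}" if v: "v \<in> space (gauss D)" for v
  proof -
    have "indicat_real ?Q (v, u) = indicat_real {u. Q (v, u)} u" for u
      using v by (simp add: indicator_def draw_measure_eq space_pair_measure)
    then show ?thesis by simp
  qed
  have "integrable (gauss D) (\<lambda>v. \<integral>u. indicat_real ?Q (v, u) \<partial>?U)"
    using P.integrable_fst'[OF int] .
  then show ?A using sec by (subst (asm) Bochner_Integration.integrable_cong[OF refl sec]) auto
  have "measure (draw_measure D) ?Q = (\<integral>w. indicat_real ?Q w \<partial>(gauss D \<Otimes>\<^sub>M ?U))"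
    by (simp add: Int_absorb2 flip: draw_measure_eq)
  also have "\<dots> = (\<integral>v. \<integral>u. indicat_real ?Q (v, u) \<partial>?U \<partial>gauss D)"
    using P.integral_fst'[OF int] by simp
  also have "\<dots> = (\<integral>v. measure ?U {u. Q (v, u)} \<partial>gauss D)"
    by (rule Bochner_Integration.integral_cong[OF refl sec])
  finally show ?B .
qed

text \<open>
  \<open>Y\<close> is a Chebyshev bound for the indicator of the event that the projection of \<open>a\<close> or \<open>b\<close>
  lies outside the range of the random threshold; in the application its expectation is at most
  \<open>4 / 9\<close>. The constants work because \<open>sqrt (2 / pi) > sqrt (4 / 9)\<close>.
\<close>

lemma threshold_loss:
  fixes h :: real
  assumes h: "0 < h" and A: "finite A" "A \<noteq> {}" and lam: "0 < \<kappa>" and z: "0 \<le> z" "0 \<le> w"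
    and Y: "Y = ((f a - \<mu>)\<^sup>2 + (f b - \<mu>)\<^sup>2 + 2 / real (card A) * (\<Sum>y\<in>A. (f y - \<mu>)\<^sup>2)) / (h / 2)\<^sup>2"
  shows "z / h - (if \<bar>f a - median f A\<bar> \<le> h \<and> \<bar>f b - median f A\<bar> \<le> h then (\<bar>f a - f b\<bar> - z - w) / (2 * h) else 0)
    \<le> (3 * z + w - \<bar>f a - f b\<bar> + (\<kappa> * Y + (f a - f b)\<^sup>2 / \<kappa>) / 2) / (2 * h)"
proof -
  have n: "0 < real (card A)" using A by (simp add: card_gt_0_iff)
  have Y0: "0 \<le> Y" unfolding Y by (intro divide_nonneg_nonneg add_nonneg_nonneg mult_nonneg_nonneg sum_nonneg) auto
  have sq: "(h / 2)\<^sup>2 \<le> t\<^sup>2" if "h / 2 \<le> \<bar>t\<bar>" for t :: real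
    using that h by (metis abs_of_pos half_gt_zero power2_abs power_mono less_imp_le)
  show ?thesis
  proof (cases "\<bar>f a - median f A\<bar> \<le> h \<and> \<bar>f b - median f A\<bar> \<le> h")
    case True
    have "0 \<le> (\<kappa> * Y + (f a - f b)\<^sup>2 / \<kappa>) / 2" using Y0 lam by simp
    then have "(3 * z + w - \<bar>f a - f b\<bar>) / (2 * h)
        \<le> (3 * z + w - \<bar>f a - f b\<bar> + (\<kappa> * Y + (f a - f b)\<^sup>2 / \<kappa>) / 2) / (2 * h)"
      using h by (intro divide_right_mono) auto
    moreover have "z / h - (\<bar>f a - f b\<bar> - z - w) / (2 * h) = (3 * z + w - \<bar>f a - f b\<bar>) / (2 * h)"
      using h by (simp add: field_simps)
    ultimately show ?thesis using True by simp
  next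
    case False
    have "(h / 2)\<^sup>2 \<le> (f a - \<mu>)\<^sup>2 + (f b - \<mu>)\<^sup>2 + 2 / real (card A) * (\<Sum>y\<in>A. (f y - \<mu>)\<^sup>2)"
    proof -
      have nn: "0 \<le> (f a - \<mu>)\<^sup>2" "0 \<le> (f b - \<mu>)\<^sup>2" "0 \<le> 2 / real (card A) * (\<Sum>y\<in>A. (f y - \<mu>)\<^sup>2)"
        by (simp_all add: sum_nonneg)
      \<comment> \<open>A distance above h from the median, broken at \<mu>, has a part of at least
        h / 2.\<close>
      consider "h / 2 \<le> \<bar>f a - \<mu>\<bar>" | "h / 2 \<le> \<bar>f b - \<mu>\<bar>" | "h / 2 < \<bar>median f A - \<mu>\<bar>"
        using False by linarith
      then show ?thesis
      proof cases
        case 1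
        with sq[of "f a - \<mu>"] nn show ?thesis by linarith
      next
        case 2
        with sq[of "f b - \<mu>"] nn show ?thesis by linarith
      next
        case 3
        let ?F = "{y \<in> A. h / 2 \<le> \<bar>f y - \<mu>\<bar>}"
        have "real (card A) \<le> 2 * real (card ?F)"
          using card_far_from_median[OF A 3] by linarith
        then have "real (card A) / 2 * (h / 2)\<^sup>2 \<le> real (card ?F) * (h / 2)\<^sup>2"
          by (intro mult_right_mono) auto
        also have "\<dots> \<le> (\<Sum>y\<in>?F. (f y - \<mu>)\<^sup>2)"
          using sq by (intro sum_bounded_below) auto
        also have "\<dots> \<le> (\<Sum>y\<in>A. (f y - \<mu>)\<^sup>2)"
          using A by (intro sum_mono2) auto
        finally have "(h / 2)\<^sup>2 \<le> 2 / real (card A) * (\<Sum>y\<in>A. (f y - \<mu>)\<^sup>2)"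
          using n by (simp add: field_simps)
        with nn show ?thesis by linarith
      qed
    qed
    then have "1 \<le> Y" unfolding Y using h by (simp add: le_divide_eq)
    then have "\<kappa> \<le> \<kappa> * Y" using lam by simp
    \<comment> \<open>Here the gain from separation is lost. The inequality of arithmetic and
      geometric means bounds it by quantities with computable expectation; it is a Cauchy-Schwarz
      estimate with \<kappa> still to be optimised.\<close>
    moreover have "2 * \<bar>f a - f b\<bar> \<le> \<kappa> + (f a - f b)\<^sup>2 / \<kappa>"
    proof -
      have "0 \<le> (\<kappa> - \<bar>f a - f b\<bar>)\<^sup>2 / \<kappa>" using lam by simp
      then show ?thesis using lam by (simp add: power2_eq_square field_simps)
    qed
    ultimately have "2 * z \<le> 3 * z + w - \<bar>f a - f b\<bar> + (\<kappa> * Y + (f a - f b)\<^sup>2 / \<kappa>) / 2"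
      using z by (simp add: field_simps)
    then have "2 * z / (2 * h) \<le> (3 * z + w - \<bar>f a - f b\<bar> + (\<kappa> * Y + (f a - f b)\<^sup>2 / \<kappa>) / 2) / (2 * h)"
      using h by (intro divide_right_mono) auto
    with False show ?thesis by auto
  qed
qed

text \<open>The mean of |X| for a standard normal X; it has to exceed 2/3 with some room for the
  widths of the balls.\<close>

lemma sqrt_2_over_pi_ge: "79 / 100 \<le> sqrt (2 / pi)"
proof (rule real_le_rsqrt)
  have "pi \<le> 32 / 10" using pi_approx by simp
  then have "2 / (32 / 10) \<le> 2 / pi" by (intro divide_left_mono) auto
  then show "(79 / 100)\<^sup>2 \<le> 2 / pi" by (simp add: power2_eq_square)
qed

text \<open>Integrates the bound for a fixed direction over the direction. The centres
  \<open>a\<close> and \<open>b\<close> are data points, around which the chaining bound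
  applies.\<close>

lemma expected_children_meeting_both:
  assumes D: "0 < D" and d: "1 \<le> d" and A: "finite A" "A \<subseteq> Rn D" "doubling D d A" and x: "x \<in> A"
    and A1: "A1 \<subseteq> A" "a \<in> A1" "\<And>y. y \<in> A1 \<Longrightarrow> edist_n D a y \<le> R"
    and A2: "A2 \<subseteq> A" "b \<in> A2" "\<And>y. y \<in> A2 \<Longrightarrow> edist_n D b y \<le> R"
    and R: "0 < R" "1300 * real d * R \<le> edist_n D a b"
  shows "measure (draw_measure D) {w \<in> space (draw_measure D).
        (\<exists>y\<in>A1. goes_left D A x w y) \<and> (\<exists>y\<in>A2. goes_left D A x w y)}
    + measure (draw_measure D) {w \<in> space (draw_measure D).
        (\<exists>y\<in>A1. \<not> goes_left D A x w y) \<and> (\<exists>y\<in>A2. \<not> goes_left D A x w y)}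
    \<le> 1 - edist_n D a b / (200 * Max ((\<lambda>z. edist_n D x z) ` A))"
proof -
  interpret prob_space "gauss D" using D by (rule prob_space_gauss)
  let ?U = "uniform_measure lborel {-1..1::real}"
  define \<Delta> where "\<Delta> = Max ((\<lambda>z. edist_n D x z) ` A)"
  define l where "l = edist_n D a b"
  define h where "h = 6 * \<Delta> / sqrt (real D)"
  \<comment> \<open>The minimiser of \<kappa> * 4/9 + e^2 / \<kappa> for e = l / sqrt D; both terms
    become 2/3 * e.\<close>
  define \<kappa> where "\<kappa> = 3 / 2 * (l / sqrt (real D))"
  have sD: "0 < sqrt (real D)" using D by simp
  have le\<Delta>: "edist_n D x y \<le> \<Delta>" if "y \<in> A" for y
    unfolding \<Delta>_def using A that by (intro Max_ge) auto
  have aA: "a \<in> A" and bA: "b \<in> A" using A1 A2 by auto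
  have "0 < 1300 * real d * R" using d R by simp
  then have l: "0 < l" using R(2) unfolding l_def by linarith
  have "l \<le> \<Delta> + \<Delta>"
    using edist_n_triangle[of D a b x] le\<Delta>[OF aA] le\<Delta>[OF bA] unfolding l_def edist_n_commute[of D a x]
    by linarith
  with l have \<Delta>: "0 < \<Delta>" by linarith
  have h: "0 < h" using \<Delta> sD by (simp add: h_def)
  have lam: "0 < \<kappa>" using l sD by (simp add: \<kappa>_def)
  have fin: "finite A1" "finite A2" using A A1 A2 by (auto intro: finite_subset)
  obtain Z where Z: "integrable (gauss D) Z"
    "\<And>v y. y \<in> A \<Longrightarrow> edist_n D a y \<le> R \<Longrightarrow> \<bar>dot D y v - dot D a v\<bar> \<le> Z v"
    "(\<integral>v. Z v \<partial>gauss D) \<le> 19 * real d * R / sqrt (real D)"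
    using chaining_bound[OF D d A, of a R] aA A R by blast
  obtain W where W: "integrable (gauss D) W"
    "\<And>v y. y \<in> A \<Longrightarrow> edist_n D b y \<le> R \<Longrightarrow> \<bar>dot D y v - dot D b v\<bar> \<le> W v"
    "(\<integral>v. W v \<partial>gauss D) \<le> 19 * real d * R / sqrt (real D)"
    using chaining_bound[OF D d A, of b R] bA A R by blast
  have ZW0: "0 \<le> Z v" "0 \<le> W v" for v
    using Z(2)[OF aA, of v] W(2)[OF bA, of v] R(1) by simp_all
  define q where "q y v = (dot D (\<lambda>i. y i - x i) v)\<^sup>2" for y v
  define Y where "Y v = (q a v + q b v + 2 / real (card A) * (\<Sum>y\<in>A. q y v)) / (h / 2)\<^sup>2" for v
  have q_int: "integrable (gauss D) (q y)" for y unfolding q_def using D by simp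
  \<comment> \<open>h / 2 = 3 * \<Delta> / sqrt D is at least three standard deviations of the
    projection of y - x, whence the 9.\<close>
  have q_le: "(\<integral>v. q y v \<partial>gauss D) \<le> (h / 2)\<^sup>2 / 9" if "y \<in> A" for y
  proof -
    have "(\<integral>v. q y v \<partial>gauss D) = (edist_n D x y)\<^sup>2 / real D"
      unfolding q_def edist_n_commute[of D x] using D by (simp add: integral_dot_sq_gauss edist_n_def)
    also have "\<dots> \<le> \<Delta>\<^sup>2 / real D"
      using le\<Delta>[OF that] by (intro divide_right_mono power_mono) auto
    also have "\<dots> = (h / 2)\<^sup>2 / 9" using D by (simp add: h_def power_divide power_mult_distrib)
    finally show ?thesis .
  qed
  have Y_int: "integrable (gauss D) Y" unfolding Y_def using q_int by simp
  \<comment> \<open>One ninth each for \<open>a\<close> and \<open>b\<close>, and two for the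
    median, since half of the data suffices to move it.\<close>
  have Y_le: "(\<integral>v. Y v \<partial>gauss D) \<le> 4 / 9"
  proof -
    have n: "0 < real (card A)" using A x by (auto simp: card_gt_0_iff)
    have "(\<integral>v. Y v \<partial>gauss D) = ((\<integral>v. q a v \<partial>gauss D) + (\<integral>v. q b v \<partial>gauss D)
        + 2 / real (card A) * (\<Sum>y\<in>A. \<integral>v. q y v \<partial>gauss D)) / (h / 2)\<^sup>2"
      unfolding Y_def using q_int by simp
    also have "\<dots> \<le> ((h / 2)\<^sup>2 / 9 + (h / 2)\<^sup>2 / 9
        + 2 / real (card A) * (real (card A) * ((h / 2)\<^sup>2 / 9))) / (h / 2)\<^sup>2"
      using q_le aA bA by (intro divide_right_mono add_mono mult_left_mono sum_bounded_above) auto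
    also have "\<dots> = 4 / 9" using n h by (simp add: field_simps)
    finally show ?thesis .
  qed
  define X where "X v = dot D (\<lambda>i. a i - b i) v" for v
  have X_int: "integrable (gauss D) (\<lambda>v. \<bar>X v\<bar>)" "integrable (gauss D) (\<lambda>v. (X v)\<^sup>2)"
    unfolding X_def using D by simp_all
  have X_abs: "(\<integral>v. \<bar>X v\<bar> \<partial>gauss D) = sqrt (2 / pi) * (l / sqrt (real D))"
    unfolding X_def l_def edist_n_def by (rule integral_abs_dot_gauss[OF D])
  have X_sq: "(\<integral>v. (X v)\<^sup>2 \<partial>gauss D) = (l / sqrt (real D))\<^sup>2"
    unfolding X_def l_def edist_n_def using D by (simp add: integral_dot_sq_gauss power_divide)
  define L where "L w \<longleftrightarrow> (\<exists>y\<in>A1. goes_left D A x w y) \<and> (\<exists>y\<in>A2. goes_left D A x w y)" for w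
  define G where "G w \<longleftrightarrow> (\<exists>y\<in>A1. \<not> goes_left D A x w y) \<and> (\<exists>y\<in>A2. \<not> goes_left D A x w y)" for w
  have L: "{w \<in> space (draw_measure D). L w} \<in> sets (draw_measure D)"
    unfolding L_def using fin A(1) by measurable
  have G: "{w \<in> space (draw_measure D). G w} \<in> sets (draw_measure D)"
    unfolding G_def using fin A(1) by measurable
  define F where "F v = (3 * Z v + W v - \<bar>X v\<bar> + (\<kappa> * Y v + (X v)\<^sup>2 / \<kappa>) / 2) / (2 * h)" for v
  have F_int: "integrable (gauss D) F"
    unfolding F_def using Z W Y_int X_int by simp
  have pointwise: "measure ?U {u. L (v, u)} + measure ?U {u. G (v, u)} \<le> 1 + F v" for v
  proof -
    define m where "m = median (\<lambda>z. dot D z v) A"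
    have gl: "goes_left D A x (v, u) y \<longleftrightarrow> dot D y v < m + u * h" for u y
      by (simp add: goes_left_iff m_def h_def \<Delta>_def)
    have "measure ?U {u. L (v, u)} + measure ?U {u. G (v, u)} \<le> 1 + Z v / h
        - (if \<bar>dot D a v - m\<bar> \<le> h \<and> \<bar>dot D b v - m\<bar> \<le> h
           then (\<bar>dot D a v - dot D b v\<bar> - Z v - W v) / (2 * h) else 0)"
      unfolding L_def G_def gl
      using Z(2) W(2) A1 A2 by (intro split_uniform_threshold[OF h fin(1) _ fin(2)]) auto
    also have "\<dots> \<le> 1 + F v"
      using threshold_loss[OF h A(1) _ lam ZW0(1)[of v] ZW0(2)[of v], of "Y v" "\<lambda>z. dot D z v" a "dot D x v" b] x
      by (simp add: Y_def q_def F_def X_def dot_diff m_def) force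
    finally show ?thesis .
  qed
  have F_le: "(\<integral>v. F v \<partial>gauss D) \<le> - (l / (200 * \<Delta>))"
  proof -
    have "(\<integral>v. F v \<partial>gauss D) = (3 * (\<integral>v. Z v \<partial>gauss D) + (\<integral>v. W v \<partial>gauss D) - sqrt (2 / pi) * (l / sqrt (real D))
        + (\<kappa> * (\<integral>v. Y v \<partial>gauss D) + (l / sqrt (real D))\<^sup>2 / \<kappa>) / 2) / (2 * h)"
      unfolding F_def using Z W Y_int X_int by (simp add: X_abs X_sq)
    also have "\<dots> \<le> (3 * (19 * real d * R / sqrt (real D)) + 19 * real d * R / sqrt (real D)
        - 79 / 100 * (l / sqrt (real D)) + (\<kappa> * (4 / 9) + (l / sqrt (real D))\<^sup>2 / \<kappa>) / 2) / (2 * h)"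
      using h lam l sD sqrt_2_over_pi_ge Z(3) W(3) Y_le
      by (intro divide_right_mono add_mono diff_mono mult_left_mono mult_right_mono) simp_all
    also have "\<dots> = (76 * (real d * R) - 79 / 100 * l + 2 / 3 * l) / sqrt (real D) / (2 * h)"
    proof -
      have "(3 / 2 * e * (4 / 9) + e\<^sup>2 / (3 / 2 * e)) / 2 = 2 / 3 * e" if "0 < e" for e :: real
        using that by (simp add: field_simps power2_eq_square)
      then have key: "(\<kappa> * (4 / 9) + (l / sqrt (real D))\<^sup>2 / \<kappa>) / 2 = 2 / 3 * (l / sqrt (real D))"
        using l sD unfolding \<kappa>_def by (meson divide_pos_pos)
      show ?thesis unfolding key by (simp add: add_divide_distrib diff_divide_distrib)
    qed
    also have "\<dots> = (76 * (real d * R) - 79 / 100 * l + 2 / 3 * l) / (12 * \<Delta>)"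
      using sD \<Delta> by (simp add: h_def field_simps)
    \<comment> \<open>Here 79/100 - 2/3 > 12/100 and 76 / 1300 < 6/100, where 76 = 3 * 19 +
      19.\<close>
    also have "\<dots> \<le> (- 6 / 100 * l) / (12 * \<Delta>)"
      using R(2) \<Delta> l unfolding l_def[symmetric] by (intro divide_right_mono) auto
    also have "\<dots> = - (l / (200 * \<Delta>))" by simp
    finally show ?thesis .
  qed
  have "measure (draw_measure D) {w \<in> space (draw_measure D). L w}
      + measure (draw_measure D) {w \<in> space (draw_measure D). G w}
      = (\<integral>v. measure ?U {u. L (v, u)} + measure ?U {u. G (v, u)} \<partial>gauss D)"
    unfolding measure_draw_measure_eq[OF D L] measure_draw_measure_eq[OF D G]
    by (intro Bochner_Integration.integral_add[symmetric] integrable_draw_measure_section[OF D] L G)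
  also have "\<dots> \<le> (\<integral>v. 1 + F v \<partial>gauss D)"
    using F_int pointwise
    by (intro integral_mono Bochner_Integration.integrable_add integrable_draw_measure_section[OF D] L G) simp_all
  also have "\<dots> = 1 + (\<integral>v. F v \<partial>gauss D)" using F_int by (simp add: prob_space)
  also have "\<dots> \<le> 1 - l / (200 * \<Delta>)" using F_le by simp
  finally show ?thesis unfolding L_def G_def l_def \<Delta>_def .
qed

subsection \<open>Radius of a cell\<close>

lemma closed_ball_mono: "r \<le> r' \<Longrightarrow> closed_ball D c r \<subseteq> closed_ball D c r'"
  unfolding closed_ball_def by (blast intro: order_trans)

lemma radius_le: "c \<in> Rn D \<Longrightarrow> 0 \<le> r \<Longrightarrow> A \<subseteq> closed_ball D c r \<Longrightarrow> radius D A \<le> r"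
  unfolding radius_def by (intro cInf_lower bdd_belowI[of _ 0]) auto

lemma radius_set_nonempty:
  assumes "finite A" "A \<subseteq> Rn D"
  shows "{r. 0 \<le> r \<and> (\<exists>c\<in>Rn D. A \<subseteq> closed_ball D c r)} \<noteq> {}"
proof -
  obtain c where c: "c \<in> Rn D" by (meson PiE_eq_empty_iff UNIV_not_empty ex_in_conv)
  have "A \<subseteq> closed_ball D c (\<Sum>y\<in>A. edist_n D c y)"
    using assms member_le_sum[of _ A "edist_n D c"] by (auto simp: closed_ball_def)
  then show ?thesis using c by (auto intro!: exI[of _ "\<Sum>y\<in>A. edist_n D c y"] sum_nonneg)
qed

lemma radius_nonneg: "finite A \<Longrightarrow> A \<subseteq> Rn D \<Longrightarrow> 0 \<le> radius D A"
  unfolding radius_def using radius_set_nonempty by (intro cInf_greatest) auto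

text \<open>Passing to a strictly larger \<open>r\<close> avoids any appeal to attainment of the
  infimum.\<close>

lemma radius_cover:
  assumes "finite A" "A \<subseteq> Rn D" "radius D A < r"
  shows "\<exists>c\<in>Rn D. A \<subseteq> closed_ball D c r"
  using cInf_lessD[OF radius_set_nonempty[OF assms(1,2)]] assms(3) closed_ball_mono
  unfolding radius_def by (smt (verit) mem_Collect_eq order_trans)

lemma radius_mono: "A \<subseteq> B \<Longrightarrow> finite B \<Longrightarrow> B \<subseteq> Rn D \<Longrightarrow> radius D A \<le> radius D B"
  unfolding radius_def
  by (intro cInf_superset_mono radius_set_nonempty bdd_belowI[of _ 0]) (auto, meson order_trans)

lemma edist_n_le_radius:
  assumes A: "finite A" "A \<subseteq> Rn D" and y: "y \<in> A" "z \<in> A"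
  shows "edist_n D y z \<le> 2 * radius D A"
proof (rule field_le_epsilon)
  fix e :: real assume "0 < e"
  then obtain c where "A \<subseteq> closed_ball D c (radius D A + e / 2)"
    using radius_cover[OF A, of "radius D A + e / 2"] by auto
  with y have "edist_n D c y \<le> radius D A + e / 2" "edist_n D c z \<le> radius D A + e / 2"
    by (auto simp: closed_ball_def)
  with edist_n_triangle[of D y z c] show "edist_n D y z \<le> 2 * radius D A + e"
    unfolding edist_n_commute[of D y c] by linarith
qed

text \<open>Around any data point, the ball reaching its farthest data point covers everything. This
  turns a large radius into two distant points.\<close>

lemma radius_le_edist_n:
  assumes A: "finite A" "A \<noteq> {}" "A \<subseteq> Rn D"
  shows "\<exists>y\<in>A. \<exists>z\<in>A. radius D A \<le> edist_n D y z"
proof -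
  obtain y where y: "y \<in> A" using A by blast
  have "Max ((\<lambda>z. edist_n D y z) ` A) \<in> (\<lambda>z. edist_n D y z) ` A" using A by (intro Max_in) auto
  then obtain z where z: "z \<in> A" "Max ((\<lambda>z. edist_n D y z) ` A) = edist_n D y z" by auto
  have "A \<subseteq> closed_ball D y (edist_n D y z)"
    using A unfolding z(2)[symmetric] by (auto simp: closed_ball_def)
  then have "radius D A \<le> edist_n D y z"
    using A y by (intro radius_le) auto
  with y z show ?thesis by blast
qed

lemma radius_empty [simp]: "radius D {} = 0"
proof -
  obtain c where c: "c \<in> Rn D" by (meson PiE_eq_empty_iff UNIV_not_empty ex_in_conv)
  then have "radius D {} \<le> 0" by (intro radius_le[of c]) auto
  with radius_nonneg[of "{}" D] show ?thesis by simp
qed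

section \<open>Sums over binary words, and resampling one coordinate of a product measure\<close>

lemma sum_bool_lists_Suc:
  "(\<Sum>q | length q = Suc n. f q) = (\<Sum>q | length q = n. f (True # q) + f (False # q))"
  for f :: "bool list \<Rightarrow> real"
proof -
  have fin: "finite {q::bool list. length q = n}"
    using finite_lists_length_eq[of "UNIV::bool set" n] by simp
  have "{q::bool list. length q = Suc n} = (\<lambda>q. True # q) ` {q. length q = n} \<union> (\<lambda>q. False # q) ` {q. length q = n}"
    by (auto simp: length_Suc_conv image_iff)
  moreover have "(\<lambda>q. True # q) ` {q. length q = n} \<inter> (\<lambda>q. False # q) ` {q. length q = n} = {}" by auto
  ultimately have "(\<Sum>q | length q = Suc n. f q) =
      (\<Sum>q\<in>(\<lambda>q. True # q) ` {q. length q = n}. f q) + (\<Sum>q\<in>(\<lambda>q. False # q) ` {q. length q = n}. f q)"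
    using fin by (simp only: sum.union_disjoint[OF finite_imageI[OF fin] finite_imageI[OF fin]])
  also have "\<dots> = (\<Sum>q | length q = n. f (True # q)) + (\<Sum>q | length q = n. f (False # q))"
    by (simp add: sum.reindex inj_on_def)
  finally show ?thesis by (simp add: sum.distrib)
qed

text \<open>Overwriting one coordinate by an independent fresh draw preserves the product measure;
  Fubini then integrates the fresh draw first.\<close>

lemma measure_PiM_resample_coordinate:
  assumes M: "prob_space M" and E: "{\<omega> \<in> space (PiM UNIV (\<lambda>_. M)). E \<omega>} \<in> sets (PiM UNIV (\<lambda>_. M))"
  shows "integrable (PiM UNIV (\<lambda>_. M)) (\<lambda>\<omega>. measure M {z \<in> space M. E (fun_upd \<omega> i z)})" (is ?A)
    and "measure (PiM UNIV (\<lambda>_. M)) {\<omega> \<in> space (PiM UNIV (\<lambda>_. M)). E \<omega>} =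
      (\<integral>\<omega>. measure M {z \<in> space M. E (fun_upd \<omega> i z)} \<partial>PiM UNIV (\<lambda>_. M))" (is ?B)
proof -
  let ?T = "PiM UNIV (\<lambda>_. M)"
  let ?E = "{\<omega> \<in> space ?T. E \<omega>}"
  let ?u = "\<lambda>(z, \<omega>). fun_upd \<omega> i z"
  interpret M: prob_space M by fact
  interpret T: prob_space ?T by (intro prob_space_PiM M)
  interpret P: pair_prob_space M ?T ..
  have distr: "distr (M \<Otimes>\<^sub>M ?T) ?T ?u = ?T"
    using distr_pair_PiM_eq_PiM[of UNIV "\<lambda>_. M" i] M by simp
  have meas: "?u \<in> measurable (M \<Otimes>\<^sub>M ?T) ?T"
    using measurable_fun_upd[of UNIV UNIV i snd "M \<Otimes>\<^sub>M ?T" "\<lambda>_. M" fst] by (simp add: case_prod_unfold)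
  define g where "g z \<omega> = indicat_real ?E (fun_upd \<omega> i z)" for z \<omega>
  have g: "case_prod g = (\<lambda>x. indicat_real ?E (?u x))" by (auto simp: g_def fun_eq_iff)
  have int: "integrable (M \<Otimes>\<^sub>M ?T) (case_prod g)"
    unfolding g using measurable_compose[OF meas borel_measurable_indicator[OF E]]
    by (intro P.integrable_const_bound[where B = 1]) auto
  have sec: "(\<integral>z. g z \<omega> \<partial>M) = measure M {z \<in> space M. E (fun_upd \<omega> i z)}" if "\<omega> \<in> space ?T" for \<omega>
  proof -
    have "(\<integral>z. g z \<omega> \<partial>M) = (\<integral>z. indicat_real {z \<in> space M. E (fun_upd \<omega> i z)} z \<partial>M)"
      using that by (intro Bochner_Integration.integral_cong) (auto simp: g_def indicator_def space_PiM PiE_iff)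
    then show ?thesis by (simp add: Int_absorb2)
  qed
  have "integrable ?T (\<lambda>\<omega>. \<integral>z. g z \<omega> \<partial>M)"
    using P.integrable_snd[OF int] .
  then show ?A using sec by (subst (asm) Bochner_Integration.integrable_cong[OF refl sec]) auto
  have "measure ?T ?E = (\<integral>\<omega>. indicat_real ?E \<omega> \<partial>distr (M \<Otimes>\<^sub>M ?T) ?T ?u)"
    unfolding distr by (simp add: Int_absorb2)
  also have "\<dots> = (\<integral>x. indicat_real ?E (?u x) \<partial>(M \<Otimes>\<^sub>M ?T))"
    by (rule integral_distr[OF meas borel_measurable_indicator[OF E]])
  also have "\<dots> = (\<integral>\<omega>. \<integral>z. g z \<omega> \<partial>M \<partial>?T)"
    using P.integral_snd[OF int] g by simp
  also have "\<dots> = (\<integral>\<omega>. measure M {z \<in> space M. E (fun_upd \<omega> i z)} \<partial>?T)"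
    by (rule Bochner_Integration.integral_cong[OF refl sec])
  finally show ?B .
qed

text \<open>Stands in for conditioning on all coordinates except \<open>i\<close>: the history
  \<open>H\<close> ignores that coordinate, and on \<open>H\<close> the two fresh probabilities are
  bounded pointwise.\<close>

lemma measure_PiM_two_events_le:
  fixes M :: "'a measure" and i :: 'i
  defines "T \<equiv> PiM UNIV (\<lambda>_::'i. M)"
  assumes M: "prob_space M"
    and H: "Measurable.pred T H" and E: "Measurable.pred T E" and F: "Measurable.pred T F"
    and indep: "\<And>\<omega> z. \<omega> \<in> space T \<Longrightarrow> z \<in> space M \<Longrightarrow> H (fun_upd \<omega> i z) \<longleftrightarrow> H \<omega>"
    and le: "\<And>\<omega>. \<omega> \<in> space T \<Longrightarrow> H \<omega> \<Longrightarrow>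
      measure M {z \<in> space M. E (fun_upd \<omega> i z)} + measure M {z \<in> space M. F (fun_upd \<omega> i z)} \<le> \<beta>"
  shows "measure T {\<omega> \<in> space T. H \<omega> \<and> E \<omega>} + measure T {\<omega> \<in> space T. H \<omega> \<and> F \<omega>}
    \<le> \<beta> * measure T {\<omega> \<in> space T. H \<omega>}"
proof -
  interpret T: prob_space T unfolding T_def by (intro prob_space_PiM M)
  have HE: "{\<omega> \<in> space T. H \<omega> \<and> E \<omega>} \<in> sets T" and HF: "{\<omega> \<in> space T. H \<omega> \<and> F \<omega>} \<in> sets T"
    and HH: "{\<omega> \<in> space T. H \<omega>} \<in> sets T"
    using H E F by measurable
  note eE = measure_PiM_resample_coordinate[OF M HE[unfolded T_def], of i, folded T_def]
  note eF = measure_PiM_resample_coordinate[OF M HF[unfolded T_def], of i, folded T_def]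
  have "measure T {\<omega> \<in> space T. H \<omega> \<and> E \<omega>} + measure T {\<omega> \<in> space T. H \<omega> \<and> F \<omega>} =
    (\<integral>\<omega>. measure M {z \<in> space M. H (fun_upd \<omega> i z) \<and> E (fun_upd \<omega> i z)}
      + measure M {z \<in> space M. H (fun_upd \<omega> i z) \<and> F (fun_upd \<omega> i z)} \<partial>T)"
    unfolding eE(2) eF(2) using eE(1) eF(1) by (rule Bochner_Integration.integral_add[symmetric])
  also have "\<dots> \<le> (\<integral>\<omega>. \<beta> * indicat_real {\<omega> \<in> space T. H \<omega>} \<omega> \<partial>T)"
  proof (rule integral_mono)
    show "integrable T (\<lambda>\<omega>. \<beta> * indicat_real {\<omega> \<in> space T. H \<omega>} \<omega>)"
      using HH by (simp add: less_top[symmetric])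
    fix \<omega> assume w: "\<omega> \<in> space T"
    show "measure M {z \<in> space M. H (fun_upd \<omega> i z) \<and> E (fun_upd \<omega> i z)}
        + measure M {z \<in> space M. H (fun_upd \<omega> i z) \<and> F (fun_upd \<omega> i z)} \<le> \<beta> * indicat_real {\<omega> \<in> space T. H \<omega>} \<omega>"
    proof (cases "H \<omega>")
      case True
      then show ?thesis using le[OF w True] indep[OF w] w by (simp cong: conj_cong)
    next
      case False
      then show ?thesis using indep[OF w] w by (simp cong: conj_cong)
    qed
  qed (intro Bochner_Integration.integrable_add eE(1) eF(1))
  also have "\<dots> = \<beta> * measure T {\<omega> \<in> space T. H \<omega>}" by (simp add: Int_absorb2)
  finally show ?thesis .
qed

subsection \<open>The tree below a cell\<close>

lemma cell_subset: "cell D S pick \<omega> p \<subseteq> S"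
  by (induction p) auto

lemma cell_append_subset: "cell D S pick \<omega> (q @ p) \<subseteq> cell D S pick \<omega> p"
  by (induction q) auto

text \<open>Strict suffixes of an address are the proper ancestors. The draw at \<open>p\<close>
  itself decides the children of \<open>p\<close>, not its own cell.\<close>

lemma cell_cong:
  assumes pick: "valid_pick D S pick" and w: "\<omega> \<in> space (tree_measure D)" "\<omega>' \<in> space (tree_measure D)"
  shows "(\<And>p'. strict_suffix p' p \<Longrightarrow> \<omega> p' = \<omega>' p') \<Longrightarrow> cell D S pick \<omega> p = cell D S pick \<omega>' p"
proof (induction p)
  case (Cons b p)
  have suf: "strict_suffix p' (b # p)" if "strict_suffix p' p" for p'
    using that suffix_order.less_le_trans[of p' p "b # p"] by (simp add: suffix_ConsI)
  have "cell D S pick \<omega> p = cell D S pick \<omega>' p"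
    using Cons suf by blast
  moreover have "pick p \<omega> = pick p \<omega>'"
    using pick w Cons.prems suf unfolding valid_pick_def by blast
  moreover have "\<omega> p = \<omega>' p"
    by (rule Cons.prems) (simp add: strict_suffix_def suffix_ConsI)
  ultimately show ?case by simp
qed simp

text \<open>A nonempty cell and its picked point take finitely many values, and for fixed values the
  split is measurable in the draw.\<close>

lemma measurable_cell_eq:
  assumes pick: "valid_pick D S pick" and S: "finite S"
  shows "Measurable.pred (tree_measure D) (\<lambda>\<omega>. cell D S pick \<omega> p = A)"
proof (induction p arbitrary: A)
  case (Cons b p)
  have coord: "(\<lambda>\<omega>. \<omega> p) \<in> measurable (tree_measure D) (draw_measure D)"
    unfolding tree_measure_def by simp
  have left: "Measurable.pred (tree_measure D) (\<lambda>\<omega>. goes_left D B x (\<omega> p) y)" if "finite B" for B x y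
    using measurable_compose[OF coord measurable_goes_left[OF that]] .
  have picked: "Measurable.pred (tree_measure D) (\<lambda>\<omega>. pick p \<omega> = x)" for x
  proof -
    have "pick p \<in> measurable (tree_measure D) (count_space UNIV)"
      using pick by (simp add: valid_pick_def)
    from measurable_compose[OF this, of "\<lambda>z. z = x" "count_space UNIV"] show ?thesis by simp
  qed
  define Q where "Q B x \<omega> \<longleftrightarrow> cell D S pick \<omega> p = B \<and> pick p \<omega> = x \<and> {y \<in> B. goes_left D B x (\<omega> p) y \<longleftrightarrow> b} = A"
    for B x \<omega>
  have Q: "Measurable.pred (tree_measure D) (Q B x)" if "B \<subseteq> S" for B x
  proof -
    have B: "finite B" using that S by (rule finite_subset)
    have "{y \<in> B. goes_left D B x w y \<longleftrightarrow> b} = A \<longleftrightarrow> A \<subseteq> B \<and> (\<forall>y\<in>B. y \<in> A \<longleftrightarrow> (goes_left D B x w y \<longleftrightarrow> b))" for w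
      by blast
    then show ?thesis
      unfolding Q_def[abs_def] using left[OF B] picked Cons.IH B by simp
  qed
  \<comment> \<open>Empty cells are set apart: there \<open>pick\<close> is not confined to
    \<open>S\<close> and may take infinitely many values.\<close>
  have split: "cell D S pick \<omega> (b # p) = A \<longleftrightarrow>
      (cell D S pick \<omega> p = {} \<and> A = {}) \<or> (\<exists>B\<in>Pow S - {{}}. \<exists>x\<in>S. Q B x \<omega>)"
    if w: "\<omega> \<in> space (tree_measure D)" for \<omega>
  proof -
    have "cell D S pick \<omega> (b # p) = A \<longleftrightarrow> Q (cell D S pick \<omega> p) (pick p \<omega>) \<omega>"
      by (simp add: Q_def)
    moreover have "cell D S pick \<omega> p = B" "pick p \<omega> = x" if "Q B x \<omega>" for B x
      using that by (simp_all add: Q_def)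
    moreover have "pick p \<omega> \<in> S" if "cell D S pick \<omega> p \<noteq> {}"
      using that pick w cell_subset[of D S pick \<omega> p] unfolding valid_pick_def by blast
    moreover have "cell D S pick \<omega> (b # p) = {}" if "cell D S pick \<omega> p = {}"
      using that by simp
    moreover have "cell D S pick \<omega> p \<in> Pow S" using cell_subset by blast
    ultimately show ?thesis by blast
  qed
  have "Measurable.pred (tree_measure D) (\<lambda>\<omega>. \<exists>B\<in>Pow S - {{}}. \<exists>x\<in>S. Q B x \<omega>)"
    using S Q by (intro pred_intros_finite) auto
  then have "Measurable.pred (tree_measure D)
      (\<lambda>\<omega>. (cell D S pick \<omega> p = {} \<and> A = {}) \<or> (\<exists>B\<in>Pow S - {{}}. \<exists>x\<in>S. Q B x \<omega>))"
    using Cons.IH[of "{}"] by (intro pred_intros_logic) simp_all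
  moreover have "Measurable.pred (tree_measure D) (\<lambda>\<omega>. cell D S pick \<omega> (b # p) = A) \<longleftrightarrow>
      Measurable.pred (tree_measure D)
      (\<lambda>\<omega>. (cell D S pick \<omega> p = {} \<and> A = {}) \<or> (\<exists>B\<in>Pow S - {{}}. \<exists>x\<in>S. Q B x \<omega>))"
    using split by (intro measurable_cong)
  ultimately show ?case by (rule iffD2[rotated])
qed simp

text \<open>All draws outside the subtree at \<open>p\<close> are frozen at
  \<open>\<omega>\<^sub>0\<close>, so the cell at \<open>p\<close> is deterministic and the
  randomness is that of its subtree. Nodes below are addressed relative to \<open>p\<close>.\<close>

locale rptree_below =
  fixes D :: nat and S :: "(nat \<Rightarrow> real) set" and pick :: pick_rule and \<omega>\<^sub>0 :: "node \<Rightarrow> draw" and p :: node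
  assumes D: "0 < D" and S: "finite S" "S \<subseteq> Rn D" and pick: "valid_pick D S pick"
    and \<omega>\<^sub>0: "\<omega>\<^sub>0 \<in> space (tree_measure D)"
begin

sublocale prob_space "tree_measure D"
  using D by (rule prob_space_tree_measure)

definition C :: "(node \<Rightarrow> draw) \<Rightarrow> node \<Rightarrow> (nat \<Rightarrow> real) set" where
  "C \<omega> q = cell D S pick (resample p \<omega>\<^sub>0 \<omega>) (q @ p)"

definition x :: "(node \<Rightarrow> draw) \<Rightarrow> node \<Rightarrow> nat \<Rightarrow> real" where
  "x \<omega> q = pick (q @ p) (resample p \<omega>\<^sub>0 \<omega>)"

lemma resample_space:
  assumes "\<omega> \<in> space (tree_measure D)"
  shows "resample p \<omega>\<^sub>0 \<omega> \<in> space (tree_measure D)"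
  using assms \<omega>\<^sub>0 by (auto simp: resample_def override_on_def tree_measure_def space_PiM PiE_iff)

lemma measurable_resample: "resample p \<omega>\<^sub>0 \<in> measurable (tree_measure D) (tree_measure D)"
  unfolding tree_measure_def
proof (rule measurable_PiM_single')
  fix q :: node
  have "\<omega>\<^sub>0 q \<in> space (draw_measure D)"
    using \<omega>\<^sub>0 by (auto simp: tree_measure_def space_PiM PiE_iff)
  then show "(\<lambda>\<omega>. resample p \<omega>\<^sub>0 \<omega> q) \<in> measurable (PiM UNIV (\<lambda>_. draw_measure D)) (draw_measure D)"
    by (cases "suffix p q") (simp_all add: resample_def override_on_def)
next
  show "resample p \<omega>\<^sub>0 \<in> space (PiM UNIV (\<lambda>_. draw_measure D)) \<rightarrow> (\<Pi>\<^sub>E i\<in>UNIV. space (draw_measure D))"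
    using resample_space by (auto simp: tree_measure_def space_PiM)
qed

lemma C_subset: "C \<omega> q \<subseteq> S"
  unfolding C_def by (rule cell_subset)

lemma C_Rn: "C \<omega> q \<subseteq> Rn D" and finite_C: "finite (C \<omega> q)"
  using C_subset S by (blast intro: finite_subset)+

lemma C_append_subset: "C \<omega> (q @ q') \<subseteq> C \<omega> q'"
  unfolding C_def append_assoc by (rule cell_append_subset)

text \<open>Addresses are read upwards, so dropping the first \<open>n\<close> entries climbs
  \<open>n\<close> levels.\<close>

lemma C_drop: "C \<omega> q \<subseteq> C \<omega> (drop n q)"
  using C_append_subset[of \<omega> "take n q" "drop n q"] by simp

lemma C_Nil:
  assumes "\<omega> \<in> space (tree_measure D)"
  shows "C \<omega> [] = cell D S pick \<omega>\<^sub>0 p"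
  unfolding C_def append_Nil
  by (rule cell_cong[OF pick resample_space[OF assms] \<omega>\<^sub>0])
    (auto simp: resample_def override_on_def strict_suffix_def suffix_order.antisym)

lemma C_subset_Nil: "\<omega> \<in> space (tree_measure D) \<Longrightarrow> C \<omega> q \<subseteq> cell D S pick \<omega>\<^sub>0 p"
  using C_append_subset[of \<omega> q "[]"] C_Nil by simp

lemma C_Cons:
  "C \<omega> (b # q) = {y \<in> C \<omega> q. goes_left D (C \<omega> q) (x \<omega> q) (\<omega> (q @ p)) y \<longleftrightarrow> b}"
proof -
  have "suffix p (q @ p)" by (simp add: suffix_def)
  then show ?thesis by (simp add: C_def x_def resample_def override_on_def)
qed

lemma x_in_C: "\<omega> \<in> space (tree_measure D) \<Longrightarrow> C \<omega> q \<noteq> {} \<Longrightarrow> x \<omega> q \<in> C \<omega> q"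
  using pick resample_space unfolding valid_pick_def C_def x_def by blast

text \<open>The draw at a node is used strictly below it. This makes the fresh draw at
  \<open>q @ p\<close> independent of the history.\<close>

lemma
  assumes w: "\<omega> \<in> space (tree_measure D)" and z: "z \<in> space (draw_measure D)" and q': "suffix q' q"
  shows C_upd: "C (fun_upd \<omega> (q @ p) z) q' = C \<omega> q'"
    and x_upd: "x (fun_upd \<omega> (q @ p) z) q' = x \<omega> q'"
proof -
  have w': "fun_upd \<omega> (q @ p) z \<in> space (tree_measure D)"
    using w z by (auto simp: tree_measure_def space_PiM PiE_iff)
  have eq: "resample p \<omega>\<^sub>0 (fun_upd \<omega> (q @ p) z) p' = resample p \<omega>\<^sub>0 \<omega> p'" if "strict_suffix p' (q' @ p)" for p'
  proof -
    have "length p' < length (q' @ p)" using that by (rule suffix_length_less)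
    also have "length (q' @ p) \<le> length (q @ p)" using suffix_length_le[OF q'] by simp
    finally have "p' \<noteq> q @ p" by blast
    then show ?thesis by (simp add: resample_def override_on_def)
  qed
  show "C (fun_upd \<omega> (q @ p) z) q' = C \<omega> q'"
    unfolding C_def by (rule cell_cong[OF pick resample_space[OF w'] resample_space[OF w] eq])
  show "x (fun_upd \<omega> (q @ p) z) q' = x \<omega> q'"
    unfolding x_def using pick resample_space[OF w] resample_space[OF w'] eq
    unfolding valid_pick_def by blast
qed

text \<open>No condition on \<open>P\<close>, because \<open>C \<omega> q\<close> ranges over the
  finitely many subsets of \<open>S\<close>.\<close>

lemma measurable_C [measurable]: "Measurable.pred (tree_measure D) (\<lambda>\<omega>. P (C \<omega> q))"
proof -
  have "Measurable.pred (tree_measure D) (\<lambda>\<omega>. C \<omega> q = A)" for A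
    unfolding C_def using measurable_compose[OF measurable_resample measurable_cell_eq[OF pick S(1)]] .
  then have "Measurable.pred (tree_measure D) (\<lambda>\<omega>. \<exists>A\<in>Pow S. P A \<and> C \<omega> q = A)"
    using S(1) by (intro pred_intros_finite pred_intros_logic) auto
  moreover have "(\<lambda>\<omega>. \<exists>A\<in>Pow S. P A \<and> C \<omega> q = A) = (\<lambda>\<omega>. P (C \<omega> q))"
    using C_subset by (auto simp: fun_eq_iff)
  ultimately show ?thesis by simp
qed

end

section \<open>Expected number of cells meeting two distant balls\<close>

definition meets_both :: "nat \<Rightarrow> (nat \<Rightarrow> real) \<Rightarrow> (nat \<Rightarrow> real) \<Rightarrow> real \<Rightarrow> (nat \<Rightarrow> real) set \<Rightarrow> bool" where
  "meets_both D k k' r A \<longleftrightarrow> (\<exists>y\<in>A. edist_n D k y \<le> r) \<and> (\<exists>y\<in>A. edist_n D k' y \<le> r)"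

context rptree_below
begin

text \<open>One step of a supermartingale, on a history event \<open>H\<close> decided above the
  draw at \<open>q\<close>. The centres are moved from \<open>k\<close>, \<open>k'\<close> to data
  points, which doubles the radius of the balls (2600 = 2 * 1300); \<Delta> is at most twice the
  radius of the cell (400 = 2 * 200).\<close>

lemma prob_children_meet_both_le:
  assumes d: "1 \<le> d" and dbl: "doubling D d (cell D S pick \<omega>\<^sub>0 p)"
    and r: "0 < r" "2600 * real d * r \<le> edist_n D k k' - 2 * r"
    and H: "Measurable.pred (tree_measure D) H"
    and H_upd: "\<And>\<omega> z. \<omega> \<in> space (tree_measure D) \<Longrightarrow> z \<in> space (draw_measure D) \<Longrightarrow>
      H (fun_upd \<omega> (q @ p) z) \<longleftrightarrow> H \<omega>"
    and H_meets: "\<And>\<omega>. H \<omega> \<Longrightarrow> meets_both D k k' r (C \<omega> q)"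
    and \<beta>: "\<And>\<omega>. H \<omega> \<Longrightarrow> 0 < radius D (C \<omega> q) \<Longrightarrow>
      1 - (edist_n D k k' - 2 * r) / (400 * radius D (C \<omega> q)) \<le> \<beta>"
  shows "prob {\<omega> \<in> space (tree_measure D). H \<omega> \<and> meets_both D k k' r (C \<omega> (True # q))}
    + prob {\<omega> \<in> space (tree_measure D). H \<omega> \<and> meets_both D k k' r (C \<omega> (False # q))}
    \<le> \<beta> * prob {\<omega> \<in> space (tree_measure D). H \<omega>}"
proof (rule measure_PiM_two_events_le[where M = "draw_measure D" and i = "q @ p", folded tree_measure_def])
  show "prob_space (draw_measure D)" using D by (rule prob_space_draw_measure)
  show "Measurable.pred (tree_measure D) H" by (rule H)
  show "Measurable.pred (tree_measure D) (\<lambda>\<omega>. meets_both D k k' r (C \<omega> (True # q)))"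
    by (rule measurable_C)
  show "Measurable.pred (tree_measure D) (\<lambda>\<omega>. meets_both D k k' r (C \<omega> (False # q)))"
    by (rule measurable_C)
  show "H (fun_upd \<omega> (q @ p) z) \<longleftrightarrow> H \<omega>"
    if "\<omega> \<in> space (tree_measure D)" "z \<in> space (draw_measure D)" for \<omega> z
    using H_upd that .
  fix \<omega> assume w: "\<omega> \<in> space (tree_measure D)" and Hw: "H \<omega>"
  define A where "A = C \<omega> q"
  define x0 where "x0 = x \<omega> q"
  define A1 where "A1 = {y \<in> A. edist_n D k y \<le> r}"
  define A2 where "A2 = {y \<in> A. edist_n D k' y \<le> r}"
  obtain a b where ab: "a \<in> A1" "b \<in> A2"
    using H_meets[OF Hw] unfolding meets_both_def A_def[symmetric] A1_def A2_def by blast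
  have sub: "A1 \<subseteq> A" "A2 \<subseteq> A" by (auto simp: A1_def A2_def)
  have A: "finite A" "A \<subseteq> Rn D" "doubling D d A"
    unfolding A_def using finite_C C_Rn doubling_mono[OF dbl C_subset_Nil[OF w]] by auto
  have x0: "x0 \<in> A"
    unfolding A_def x0_def using x_in_C[OF w, of q] ab(1) sub by (auto simp: A_def)
  have near1: "edist_n D a y \<le> 2 * r" if "y \<in> A1" for y
    using edist_n_triangle[of D a y k] that ab(1) by (auto simp: A1_def edist_n_commute[of D a])
  have near2: "edist_n D b y \<le> 2 * r" if "y \<in> A2" for y
    using edist_n_triangle[of D b y k'] that ab(2) by (auto simp: A2_def edist_n_commute[of D b])
  define l0 where "l0 = edist_n D k k' - 2 * r"
  have l0: "l0 \<le> edist_n D a b"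
    using edist_n_triangle[of D k k' a] edist_n_triangle[of D a k' b] ab
    by (auto simp: l0_def A1_def A2_def edist_n_commute[of D b])
  have "0 < 2600 * real d * r" using d r(1) by simp
  with r(2) have l0_pos: "0 < l0" unfolding l0_def by linarith
  define \<Delta> where "\<Delta> = Max ((\<lambda>z. edist_n D x0 z) ` A)"
  have le\<Delta>: "edist_n D x0 y \<le> \<Delta>" if "y \<in> A" for y
    unfolding \<Delta>_def using A that by (intro Max_ge) auto
  have "edist_n D a b \<le> \<Delta> + \<Delta>"
    using edist_n_triangle[of D a b x0] le\<Delta>[of a] le\<Delta>[of b] ab sub
    unfolding edist_n_commute[of D a x0] by (meson add_mono order_trans subsetD)
  with l0 l0_pos have \<Delta>: "0 < \<Delta>" by linarith
  have \<Delta>_le: "\<Delta> \<le> 2 * radius D A"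
  proof -
    have "\<Delta> \<in> (\<lambda>z. edist_n D x0 z) ` A" unfolding \<Delta>_def using A x0 by (intro Max_in) auto
    then show ?thesis using edist_n_le_radius[OF A(1,2) x0] by auto
  qed
  have "measure (draw_measure D) {z \<in> space (draw_measure D). meets_both D k k' r (C (fun_upd \<omega> (q @ p) z) (True # q))}
      + measure (draw_measure D) {z \<in> space (draw_measure D). meets_both D k k' r (C (fun_upd \<omega> (q @ p) z) (False # q))}
    = measure (draw_measure D) {z \<in> space (draw_measure D).
        (\<exists>y\<in>A1. goes_left D A x0 z y) \<and> (\<exists>y\<in>A2. goes_left D A x0 z y)}
      + measure (draw_measure D) {z \<in> space (draw_measure D).
        (\<exists>y\<in>A1. \<not> goes_left D A x0 z y) \<and> (\<exists>y\<in>A2. \<not> goes_left D A x0 z y)}"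
  proof -
    have child: "C (fun_upd \<omega> (q @ p) z) (c # q) = {y \<in> A. goes_left D A x0 z y \<longleftrightarrow> c}"
      if "z \<in> space (draw_measure D)" for z c
      unfolding C_Cons C_upd[OF w that suffix_order.refl] x_upd[OF w that suffix_order.refl]
      by (simp add: A_def x0_def)
    have "{z \<in> space (draw_measure D). meets_both D k k' r (C (fun_upd \<omega> (q @ p) z) (True # q))} =
        {z \<in> space (draw_measure D). (\<exists>y\<in>A1. goes_left D A x0 z y) \<and> (\<exists>y\<in>A2. goes_left D A x0 z y)}"
      using child by (auto simp: meets_both_def A1_def A2_def)
    moreover have "{z \<in> space (draw_measure D). meets_both D k k' r (C (fun_upd \<omega> (q @ p) z) (False # q))} =
        {z \<in> space (draw_measure D). (\<exists>y\<in>A1. \<not> goes_left D A x0 z y) \<and> (\<exists>y\<in>A2. \<not> goes_left D A x0 z y)}"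
      using child by (auto simp: meets_both_def A1_def A2_def)
    ultimately show ?thesis by simp
  qed
  also have "\<dots> \<le> 1 - edist_n D a b / (200 * \<Delta>)"
    unfolding \<Delta>_def
    by (rule expected_children_meeting_both[OF D d A x0 sub(1) ab(1) near1 sub(2) ab(2) near2])
      (use r l0 in \<open>auto simp: l0_def\<close>)
  also have "\<dots> \<le> 1 - l0 / (400 * radius D A)"
  proof -
    have "l0 / (400 * radius D A) \<le> edist_n D a b / (200 * \<Delta>)"
      using l0 l0_pos \<Delta> \<Delta>_le by (intro frac_le) auto
    then show ?thesis by simp
  qed
  also have "\<dots> \<le> \<beta>"
    using \<beta>[OF Hw] \<Delta> \<Delta>_le unfolding A_def l0_def by auto
  finally show "measure (draw_measure D) {z \<in> space (draw_measure D). meets_both D k k' r (C (fun_upd \<omega> (q @ p) z) (True # q))}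
      + measure (draw_measure D) {z \<in> space (draw_measure D). meets_both D k k' r (C (fun_upd \<omega> (q @ p) z) (False # q))}
      \<le> \<beta>" .
qed

text \<open>The left-hand side is the expected number of cells at depth \<open>n\<close> that meet
  both balls. Without control of the radius the step has factor 1, which is all that is needed
  before a stage begins.\<close>

lemma sum_prob_meets_both_le_1:
  assumes d: "1 \<le> d" and dbl: "doubling D d (cell D S pick \<omega>\<^sub>0 p)"
    and r: "0 < r" "2600 * real d * r \<le> edist_n D k k' - 2 * r"
  shows "(\<Sum>q | length q = n. prob {\<omega> \<in> space (tree_measure D). meets_both D k k' r (C \<omega> q)}) \<le> 1"
proof (induction n)
  case 0
  then show ?case by simp
next
  case (Suc n)
  let ?P = "\<lambda>q. prob {\<omega> \<in> space (tree_measure D). meets_both D k k' r (C \<omega> q)}"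
  have "0 \<le> edist_n D k k' - 2 * r"
  proof -
    have "0 \<le> 2600 * real d * r" using r(1) by simp
    with r(2) show ?thesis by linarith
  qed
  have "?P (True # q) + ?P (False # q) \<le> ?P q" for q
  proof -
    have "meets_both D k k' r (C \<omega> (b # q)) \<longleftrightarrow> meets_both D k k' r (C \<omega> q) \<and> meets_both D k k' r (C \<omega> (b # q))" for \<omega> b
      using C_append_subset[of \<omega> "[b]" q] by (auto simp: meets_both_def)
    then show ?thesis
      using prob_children_meet_both_le[OF d dbl r, of "\<lambda>\<omega>. meets_both D k k' r (C \<omega> q)" q 1]
        C_upd[OF _ _ suffix_order.refl, of _ _ q] \<open>0 \<le> edist_n D k k' - 2 * r\<close> by simp
  qed
  then have "(\<Sum>q | length q = n. ?P (True # q) + ?P (False # q)) \<le> (\<Sum>q | length q = n. ?P q)"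
    by (intro sum_mono)
  with Suc show ?case unfolding sum_bool_lists_Suc by linarith
qed

text \<open>The radius is constrained once, at depth \<open>m\<close>, and cells only shrink further
  down. A radius of at most four times the gap gives the factor 1 - 1 / (4 * 400) on each of the
  next \<open>n\<close> levels.\<close>

lemma sum_prob_meets_both_le_power:
  assumes d: "1 \<le> d" and dbl: "doubling D d (cell D S pick \<omega>\<^sub>0 p)"
    and r: "0 < r" "2600 * real d * r \<le> edist_n D k k' - 2 * r"
  shows "(\<Sum>q | length q = n + m. prob {\<omega> \<in> space (tree_measure D). meets_both D k k' r (C \<omega> q) \<and>
      radius D (C \<omega> (drop n q)) \<le> 4 * (edist_n D k k' - 2 * r)}) \<le> (1599 / 1600) ^ n"
proof (induction n)
  case 0
  have "(\<Sum>q | length q = m. prob {\<omega> \<in> space (tree_measure D). meets_both D k k' r (C \<omega> q) \<and>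
      radius D (C \<omega> q) \<le> 4 * (edist_n D k k' - 2 * r)})
    \<le> (\<Sum>q | length q = m. prob {\<omega> \<in> space (tree_measure D). meets_both D k k' r (C \<omega> q)})"
    by (intro sum_mono finite_measure_mono) auto
  also have "\<dots> \<le> 1" by (rule sum_prob_meets_both_le_1[OF assms])
  finally show ?case by simp
next
  case (Suc n)
  define H where "H q \<omega> \<longleftrightarrow> meets_both D k k' r (C \<omega> q) \<and>
      radius D (C \<omega> (drop n q)) \<le> 4 * (edist_n D k k' - 2 * r)" for q \<omega>
  define H' where "H' q \<omega> \<longleftrightarrow> meets_both D k k' r (C \<omega> q) \<and>
      radius D (C \<omega> (drop (Suc n) q)) \<le> 4 * (edist_n D k k' - 2 * r)" for q \<omega>
  let ?P = "\<lambda>H. prob {\<omega> \<in> space (tree_measure D). H \<omega>}"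
  have "?P (H' (True # q)) + ?P (H' (False # q)) \<le> 1599 / 1600 * ?P (H q)" for q
  proof -
    have "H' (b # q) \<omega> \<longleftrightarrow> H q \<omega> \<and> meets_both D k k' r (C \<omega> (b # q))" for \<omega> b
      using C_append_subset[of \<omega> "[b]" q] by (auto simp: meets_both_def H_def H'_def)
    moreover have "?P (\<lambda>\<omega>. H q \<omega> \<and> meets_both D k k' r (C \<omega> (True # q)))
        + ?P (\<lambda>\<omega>. H q \<omega> \<and> meets_both D k k' r (C \<omega> (False # q))) \<le> 1599 / 1600 * ?P (H q)"
    proof (rule prob_children_meet_both_le[OF d dbl r])
      show "Measurable.pred (tree_measure D) (H q)"
        unfolding H_def[abs_def] by (intro pred_intros_logic measurable_C)
      show "H q (fun_upd \<omega> (q @ p) z) \<longleftrightarrow> H q \<omega>"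
        if "\<omega> \<in> space (tree_measure D)" "z \<in> space (draw_measure D)" for \<omega> z
        unfolding H_def C_upd[OF that suffix_order.refl] C_upd[OF that suffix_drop] ..
      show "meets_both D k k' r (C \<omega> q)" if "H q \<omega>" for \<omega>
        using that by (simp add: H_def)
      show "1 - (edist_n D k k' - 2 * r) / (400 * radius D (C \<omega> q)) \<le> 1599 / 1600"
        if "H q \<omega>" "0 < radius D (C \<omega> q)" for \<omega>
      proof -
        have "radius D (C \<omega> q) \<le> radius D (C \<omega> (drop n q))"
          by (rule radius_mono[OF C_drop finite_C C_Rn])
        also have "\<dots> \<le> 4 * (edist_n D k k' - 2 * r)" using that(1) by (simp add: H_def)
        finally show ?thesis using that(2) by (simp add: field_simps)
      qed
    qed
    ultimately show ?thesis by simp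
  qed
  then have "(\<Sum>q | length q = n + m. ?P (H' (True # q)) + ?P (H' (False # q)))
      \<le> (\<Sum>q | length q = n + m. 1599 / 1600 * ?P (H q))"
    by (intro sum_mono)
  also have "\<dots> \<le> 1599 / 1600 * (1599 / 1600) ^ n"
    using Suc unfolding H_def sum_distrib_left[symmetric] by (intro mult_left_mono) auto
  finally show ?case
    unfolding add_Suc sum_bool_lists_Suc unfolding H'_def by simp
qed

end

subsection \<open>The union bound\<close>

lemma ex_not_halved:
  fixes \<rho> :: "nat \<Rightarrow> real"
  assumes "\<rho> 0 / 2 ^ J < \<rho> J"
  shows "\<exists>i<J. \<rho> i / 2 < \<rho> (Suc i)"
proof (rule ccontr)
  assume "\<not> ?thesis"
  then have half: "\<rho> (Suc i) \<le> \<rho> i / 2" if "i < J" for i using that by force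
  have "i \<le> J \<Longrightarrow> \<rho> i \<le> \<rho> 0 / 2 ^ i" for i
  proof (induction i)
    case (Suc i)
    then have "\<rho> i / 2 \<le> \<rho> 0 / 2 ^ i / 2" by (intro divide_right_mono) auto
    with half[of i] Suc.prems show ?case by (simp add: mult.commute)
  qed simp
  with assms show False by force
qed

lemma ex_power_2_between:
  fixes y :: real
  assumes "1 \<le> y"
  shows "\<exists>m::nat. y \<le> 2 ^ m \<and> 2 ^ m \<le> 2 * y"
proof -
  define m where "m = (LEAST m. y \<le> 2 ^ m)"
  have m: "y \<le> 2 ^ m" unfolding m_def
    by (rule LeastI_ex) (meson less_imp_le one_less_numeral_iff real_arch_pow semiring_norm(76))
  have "2 ^ m \<le> 2 * y"
  proof (cases m)
    case 0
    with assms show ?thesis by simp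
  next
    case (Suc n)
    then have "\<not> y \<le> 2 ^ n" using not_less_Least[of n "\<lambda>m. y \<le> 2 ^ m"] unfolding m_def by simp
    with Suc show ?thesis by simp
  qed
  with m show ?thesis by blast
qed

text \<open>Disposes of d = 0, where the depth bound vanishes: a single ball can be halved again and
  again.\<close>

lemma doubling_0_radius:
  assumes A: "finite A" "A \<subseteq> Rn D" "doubling D 0 A"
  shows "radius D A = 0"
proof (rule ccontr)
  assume "radius D A \<noteq> 0"
  with radius_nonneg[OF A(1,2)] have pos: "0 < radius D A" by simp
  then obtain c where c: "c \<in> Rn D" "A \<subseteq> closed_ball D c (2 * radius D A)"
    using radius_cover[OF A(1,2), of "2 * radius D A"] by auto
  \<comment> \<open>Two halvings, because the initial ball has twice the radius of
    \<open>A\<close>.\<close>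
  obtain K where K: "K \<subseteq> Rn D" "finite K" "card K \<le> 1"
    "closed_ball D c (2 * radius D A) \<inter> A \<subseteq> (\<Union>e\<in>K. closed_ball D e (2 * radius D A / 2 ^ 2))"
    using doubling_cover[OF A(3) c(1), of 2 "2 * radius D A"] by auto
  have "A \<noteq> {}" using pos by auto
  then obtain y where "y \<in> A" by blast
  then obtain e where e: "e \<in> K" using K(4) c(2) by blast
  then have "K = {e}" using K(2,3) by (metis card_le_Suc0_iff_eq One_nat_def is_singletonI' is_singletonE ex_in_conv singletonD)
  then have "A \<subseteq> closed_ball D e (radius D A / 2)" using K(4) c(2) by auto
  then have "radius D A \<le> radius D A / 2" using e K(1) pos by (intro radius_le[of e]) auto
  with pos show False by simp
qed

text \<open>With ln 2 at least 2/3, J is at most 3 * ln s, and m is at most 24 * ln (s * d) because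
  20800 is below 2^15. The final constant is 6400 * 3 * 24.\<close>

lemma level_count_bounds:
  fixes s :: real and d J m :: nat
  assumes s: "2 \<le> s" and d: "1 \<le> d" and J: "2 ^ J \<le> 2 * s" and m: "2 ^ m \<le> 20800 * s * real d"
  shows "real (J * (6400 * d * m)) \<le> 460800 * ln s * (real d * ln (s * real d))"
proof -
  have ln2: "2 / 3 \<le> ln (2::real)" by (rule ln2_ge_two_thirds)
  have lns: "ln 2 \<le> ln s" using s by simp
  have "s * 1 \<le> s * real d" using s d by (intro mult_left_mono) auto
  then have sd: "2 \<le> s * real d" "s \<le> s * real d" using s by linarith+
  have lnsd: "ln 2 \<le> ln (s * real d)" using sd(1) by simp
  have "real J * ln 2 = ln (2 ^ J)" by (simp add: ln_realpow)
  also have "\<dots> \<le> ln (2 * s)" using J s by simp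
  also have "\<dots> = ln 2 + ln s" using s by (simp add: ln_mult)
  also have "\<dots> \<le> 2 * ln s" using lns by simp
  finally have J2: "real J * ln 2 \<le> 2 * ln s" .
  have "real J * (2 / 3) \<le> real J * ln 2" using ln2 by (intro mult_left_mono) auto
  with J2 have Jle: "real J \<le> 3 * ln s" by simp
  have "real m * ln 2 = ln (2 ^ m)" by (simp add: ln_realpow)
  also have "\<dots> \<le> ln (2 ^ 15 * (s * real d))"
  proof -
    have "20800 * s * real d \<le> 2 ^ 15 * (s * real d)" using sd by simp
    with m have "2 ^ m \<le> 2 ^ 15 * (s * real d)" by linarith
    then show ?thesis using sd by (subst ln_le_cancel_iff) auto
  qed
  also have "\<dots> = 15 * ln 2 + ln (s * real d)"
    using s d ln_mult[of "2 ^ 15" "s * real d"] ln_realpow[of "2::real" 15]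
    by (simp only: of_nat_numeral) simp
  also have "\<dots> \<le> 16 * ln (s * real d)" using lnsd by simp
  finally have m2: "real m * ln 2 \<le> 16 * ln (s * real d)" .
  have "real m * (2 / 3) \<le> real m * ln 2" using ln2 by (intro mult_left_mono) auto
  with m2 have mle: "real m \<le> 24 * ln (s * real d)" by simp
  have "real (J * (6400 * d * m)) = 6400 * real d * (real J * real m)" by simp
  also have "\<dots> \<le> 6400 * real d * ((3 * ln s) * (24 * ln (s * real d)))"
    using Jle mle lns ln2 by (intro mult_left_mono mult_mono) auto
  also have "\<dots> = 460800 * ln s * (real d * ln (s * real d))" by simp
  finally show ?thesis .
qed

text \<open>6400 = 4 * 1600: the decay is below 2^-(4 * d * m), while each of the four factors 4, J,
  N and N is at most 2^(d * m).\<close>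

lemma union_bound_small:
  fixes d J m :: nat
  assumes d: "1 \<le> d" and m: "4 \<le> (2::real) ^ m" "real J \<le> 2 ^ m" and N: "N \<le> (2::real) ^ (d * m)" "0 \<le> N"
  shows "real J * (N * N) * (1599 / 1600) ^ (6400 * d * m) \<le> 1 / 4"
proof -
  have "(1599 / 1600 :: real) \<le> exp (- 1 / 1600)" using exp_ge_add_one_self[of "- 1 / 1600 :: real"] by simp
  then have "(1599 / 1600 :: real) ^ (6400 * d * m) \<le> exp (- 1 / 1600) ^ (6400 * d * m)"
    by (intro power_mono) auto
  also have "\<dots> = exp (- 1) ^ (4 * d * m)"
    by (simp flip: exp_of_nat_mult)
  also have "\<dots> \<le> (1 / 2) ^ (4 * d * m)"
  proof (rule power_mono)
    have "2 \<le> exp (1::real)" using exp_ge_add_one_self[of "1::real"] by simp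
    then show "exp (- 1) \<le> (1 / 2 :: real)" by (simp add: exp_minus inverse_eq_divide field_simps)
  qed simp
  finally have pow: "(1599 / 1600 :: real) ^ (6400 * d * m) \<le> (1 / 2) ^ (4 * d * m)" .
  have md: "(2::real) ^ m \<le> 2 ^ (d * m)" using d by (intro power_increasing) auto
  have "4 * (real J * (N * N)) \<le> 2 ^ (d * m) * (2 ^ (d * m) * (2 ^ (d * m) * 2 ^ (d * m)))"
    using m N md by (intro mult_mono) (auto intro: order_trans)
  also have "\<dots> = 2 ^ (4 * d * m)" by (simp flip: power_add)
  finally have "4 * (real J * (N * N)) * (1599 / 1600) ^ (6400 * d * m) \<le> 2 ^ (4 * d * m) * (1 / 2) ^ (4 * d * m)"
    using pow by (intro mult_mono) auto
  also have "\<dots> = 1" by (simp flip: power_mult_distrib)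
  finally show ?thesis by simp
qed

context rptree_below
begin

lemma finite_root: "finite (cell D S pick \<omega>\<^sub>0 p)" and root_Rn: "cell D S pick \<omega>\<^sub>0 p \<subseteq> Rn D"
  using finite_subset[OF cell_subset S(1)] order_trans[OF cell_subset S(2)] by simp_all

text \<open>If each of \<open>J\<close> stages halved the radius, it would end below R / s. At the
  end of a failing stage two points at least one radius apart lie in balls of the cover, and their
  distance exceeds half the radius at the start of that stage.\<close>

lemma bad_descendant_witness:
  fixes s r :: real
  defines "R \<equiv> radius D (cell D S pick \<omega>\<^sub>0 p)"
  assumes s: "2 \<le> s" "s \<le> 2 ^ J" and d: "1 \<le> d" and r: "0 < r" "5200 * s * real d * r \<le> R"
    and K: "cell D S pick \<omega>\<^sub>0 p \<subseteq> (\<Union>c\<in>K. closed_ball D c r)"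
    and w: "\<omega> \<in> space (tree_measure D)" and q: "J * n \<le> length q" "R / s < radius D (C \<omega> q)"
  shows "\<exists>i<J. \<exists>k\<in>K. \<exists>k'\<in>K. 2600 * real d * r \<le> edist_n D k k' - 2 * r \<and>
    (\<exists>q'. length q' = n + i * n \<and> meets_both D k k' r (C \<omega> q') \<and>
      radius D (C \<omega> (drop n q')) \<le> 4 * (edist_n D k k' - 2 * r))"
proof -
  \<comment> \<open>The ancestor of \<open>q\<close> at depth i * n below the root cell, where stage
    \<open>i\<close> begins.\<close>
  define q' where "q' i = drop (length q - i * n) q" for i
  have len: "length (q' i) = i * n" if "i \<le> J" for i
  proof -
    have "i * n \<le> J * n" using that by (rule mult_le_mono1)
    then have "i * n \<le> length q" using q(1) by (rule order_trans)
    then show ?thesis by (simp add: q'_def)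
  qed
  have drop_q': "q' i = drop n (q' (Suc i))" if "i < J" for i
  proof -
    have "Suc i * n \<le> J * n" using that by (intro mult_le_mono1) simp
    then have "Suc i * n \<le> length q" using q(1) by (rule order_trans)
    then have "length q - i * n = n + (length q - Suc i * n)" by simp
    then show ?thesis by (simp add: q'_def)
  qed
  have mono: "radius D (C \<omega> q) \<le> radius D (C \<omega> (q' i))" for i
    unfolding q'_def by (rule radius_mono[OF C_drop finite_C C_Rn])
  have R0: "0 \<le> R" unfolding R_def by (rule radius_nonneg[OF finite_root root_Rn])
  have "q' 0 = []" by (simp add: q'_def)
  then have start: "radius D (C \<omega> (q' 0)) = R" using C_Nil[OF w] by (simp add: R_def)
  have "R / 2 ^ J \<le> R / s" using s R0 by (intro divide_left_mono) auto
  with q(2) mono[of J] have "R / 2 ^ J < radius D (C \<omega> (q' J))" by linarith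
  then obtain i where i: "i < J" "radius D (C \<omega> (q' i)) / 2 < radius D (C \<omega> (q' (Suc i)))"
    using ex_not_halved[of "\<lambda>i. radius D (C \<omega> (q' i))" J] start by auto
  let ?A = "C \<omega> (q' (Suc i))"
  have big: "R / s < radius D ?A" using q(2) mono[of "Suc i"] by linarith
  have Rs: "0 \<le> R / s" using R0 s by simp
  with big have "?A \<noteq> {}" by auto
  then obtain y z where yz: "y \<in> ?A" "z \<in> ?A" "radius D ?A \<le> edist_n D y z"
    using radius_le_edist_n[OF finite_C _ C_Rn] by blast
  have near: "\<exists>k\<in>K. edist_n D k v \<le> r" if "v \<in> ?A" for v
    using subsetD[OF K subsetD[OF C_subset_Nil[OF w] that]] unfolding closed_ball_def by blast
  obtain k k' where k: "k \<in> K" "edist_n D k y \<le> r" "k' \<in> K" "edist_n D k' z \<le> r"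
    using near[OF yz(1)] near[OF yz(2)] by blast
  have "edist_n D y z \<le> r + edist_n D k k' + r"
    using edist_n_triangle[of D y z k] edist_n_triangle[of D k z k'] k(2,4)
    unfolding edist_n_commute[of D y k] by linarith
  \<comment> \<open>Passing from data points to centres costs 2 * r, and from centres back to
    arbitrary points of the two balls another 2 * r.\<close>
  then have l0: "edist_n D y z - 4 * r \<le> edist_n D k k' - 2 * r" by simp
  \<comment> \<open>5200 = 2 * 2600: half of the distance is given up to absorb the 4 * r.\<close>
  have dr: "5200 * real d * r \<le> R / s" using r(2) s by (simp add: field_simps)
  have "5200 * 1 * r \<le> 5200 * real d * r" using d r by (intro mult_right_mono) auto
  then have "4 * r \<le> edist_n D y z / 2" using dr yz(3) big r by linarith
  with l0 have half: "edist_n D y z / 2 \<le> edist_n D k k' - 2 * r" by linarith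
  have "2600 * real d * r \<le> edist_n D k k' - 2 * r" using half dr yz(3) big by linarith
  moreover have "radius D (C \<omega> (drop n (q' (Suc i)))) \<le> 4 * (edist_n D k k' - 2 * r)"
  proof -
    have "radius D (C \<omega> (q' i)) < 2 * edist_n D y z" using i(2) yz(3) by linarith
    also have "\<dots> \<le> 4 * (edist_n D k k' - 2 * r)" using half by simp
    finally show ?thesis unfolding drop_q'[OF i(1), symmetric] by simp
  qed
  moreover have "meets_both D k k' r ?A" using yz k by (auto simp: meets_both_def)
  moreover have "length (q' (Suc i)) = n + i * n" using len[of "Suc i"] i(1) by simp
  ultimately show ?thesis using i(1) k(1,3) by blast
qed

text \<open>The probability that some cell is bad for a given stage and pair of balls is at most the
  expected number of such cells.\<close>

lemma prob_descendants_small: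
  assumes dbl: "doubling_dim D (cell D S pick \<omega>\<^sub>0 p) \<le> d" and s: "2 \<le> s"
  shows "prob {\<omega> \<in> space (tree_measure D).
      \<forall>q. real (length q) > 460800 * ln s * (real d * ln (s * real d)) \<longrightarrow>
        radius D (C \<omega> q) \<le> radius D (cell D S pick \<omega>\<^sub>0 p) / s} \<ge> 1 - 1 / 4"
proof -
  let ?C = "cell D S pick \<omega>\<^sub>0 p"
  let ?L = "460800 * ln s * (real d * ln (s * real d))"
  define R where "R = radius D ?C"
  define Good where "Good = {\<omega> \<in> space (tree_measure D). \<forall>q. real (length q) > ?L \<longrightarrow> radius D (C \<omega> q) \<le> R / s}"
  note C = finite_root root_Rn
  have dbl': "doubling D d ?C"
    using dbl unfolding doubling_dim_le_iff[OF C] doubling_def .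
  have R0: "0 \<le> R" unfolding R_def by (rule radius_nonneg[OF C])
  show ?thesis
  proof (cases "R = 0")
    case True
    have "Good = space (tree_measure D)"
      unfolding Good_def using radius_mono[OF C_subset_Nil C] True by (auto simp: R_def)
    then show ?thesis unfolding Good_def R_def by (simp add: prob_space)
  next
    case False
    with R0 have R: "0 < R" by simp
    have d: "1 \<le> d" using doubling_0_radius[OF C] dbl' False unfolding R_def by (cases d) auto
    then have "s * 1 \<le> s * real d" using s by (intro mult_left_mono) auto
    then have sd: "s \<le> s * real d" by linarith
    obtain J where J: "s \<le> 2 ^ J" "2 ^ J \<le> 2 * s" using ex_power_2_between[of s] s by auto
    \<comment> \<open>10400 = 2 * 5200, as the cover is obtained by halving a ball of radius 2 * R m
      times.\<close>
    obtain m where m: "10400 * s * real d \<le> 2 ^ m" "2 ^ m \<le> 2 * (10400 * s * real d)"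
      using ex_power_2_between[of "10400 * s * real d"] s sd by auto
    define n where "n = 6400 * d * m"
    define r where "r = 2 * R / 2 ^ m"
    have r: "0 < r" using R by (simp add: r_def)
    have r_le: "5200 * s * real d * r \<le> R"
    proof -
      have "5200 * s * real d * r = (10400 * s * real d) * (R / 2 ^ m)" by (simp add: r_def)
      also have "\<dots> \<le> 2 ^ m * (R / 2 ^ m)" using m(1) R by (intro mult_right_mono) auto
      finally show ?thesis by simp
    qed
    obtain c where c: "c \<in> Rn D" "?C \<subseteq> closed_ball D c (2 * R)"
      using radius_cover[OF C, of "2 * R"] R unfolding R_def by auto
    obtain K where K: "finite K" "card K \<le> 2 ^ (d * m)" "?C \<subseteq> (\<Union>c\<in>K. closed_ball D c r)"
      using doubling_cover[OF dbl' c(1), of m "2 * R"] c(2) unfolding r_def by (auto simp: Int_absorb1)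
    define P where "P = {(k, k') \<in> K \<times> K. 2600 * real d * r \<le> edist_n D k k' - 2 * r}"
    have "P \<subseteq> K \<times> K" by (auto simp: P_def)
    then have P: "finite P" "card P \<le> card K * card K"
      using K(1) finite_subset[of P "K \<times> K"] card_mono[of "K \<times> K" P]
      by (simp_all add: card_cartesian_product)
    define B where "B k k' q = {\<omega> \<in> space (tree_measure D). meets_both D k k' r (C \<omega> q) \<and>
        radius D (C \<omega> (drop n q)) \<le> 4 * (edist_n D k k' - 2 * r)}" for k k' q
    have B_sets: "B k k' q \<in> sets (tree_measure D)" for k k' q
      unfolding B_def by (intro predE pred_intros_logic measurable_C)
    have fin: "finite {q::node. length q = l}" for l
      using finite_lists_length_eq[of "UNIV::bool set" l] by simp
    \<comment> \<open>The index is (stage, (k, k')); the cells range over the end of that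
      stage.\<close>
    define U where "U x = (\<Union>q\<in>{q. length q = n + fst x * n}. B (fst (snd x)) (snd (snd x)) q)" for x
    have U_sets: "U x \<in> sets (tree_measure D)" for x
      unfolding U_def using fin B_sets by (intro sets.finite_UN)
    define Bad where "Bad = (\<Union>x\<in>{..<J} \<times> P. U x)"
    have finI: "finite ({..<J} \<times> P)" using P(1) by simp
    have Bad_sets: "Bad \<in> sets (tree_measure D)"
      unfolding Bad_def using finI U_sets by (intro sets.finite_UN)
    have "prob Bad \<le> (\<Sum>x\<in>{..<J} \<times> P. prob (U x))"
      unfolding Bad_def using finI U_sets by (intro finite_measure_subadditive_finite) auto
    also have "\<dots> \<le> (\<Sum>x\<in>{..<J} \<times> P. (1599 / 1600) ^ n)"
    proof (rule sum_mono)
      fix x assume "x \<in> {..<J} \<times> P"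
      then have x: "2600 * real d * r \<le> edist_n D (fst (snd x)) (snd (snd x)) - 2 * r"
        by (auto simp: P_def)
      have "prob (U x) \<le> (\<Sum>q | length q = n + fst x * n. prob (B (fst (snd x)) (snd (snd x)) q))"
        unfolding U_def using fin B_sets by (intro finite_measure_subadditive_finite) auto
      also have "\<dots> \<le> (1599 / 1600) ^ n"
        unfolding B_def by (rule sum_prob_meets_both_le_power[OF d dbl' r x])
      finally show "prob (U x) \<le> (1599 / 1600) ^ n" .
    qed
    also have "\<dots> = real J * real (card P) * (1599 / 1600) ^ n"
      by (simp add: card_cartesian_product)
    also have "\<dots> \<le> real J * (real (card K) * real (card K)) * (1599 / 1600) ^ n"
      using P(2) by (intro mult_right_mono mult_left_mono) (simp_all flip: of_nat_mult)
    also have "\<dots> \<le> 1 / 4"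
      unfolding n_def
    proof (rule union_bound_small[OF d])
      have "4 \<le> 10400 * (s * real d)" "2 * s \<le> 10400 * (s * real d)" using s sd by linarith+
      then show "4 \<le> (2::real) ^ m" "real J \<le> 2 ^ m"
        using m(1) J(2) of_nat_less_two_power[of J, where 'a = real] by linarith+
      show "real (card K) \<le> 2 ^ (d * m)"
        using K(2) by (metis of_nat_le_iff of_nat_numeral of_nat_power)
    qed simp
    finally have Bad_le: "prob Bad \<le> 1 / 4" .
    have Good_sets: "Good \<in> sets (tree_measure D)" 
      unfolding Good_def by (intro predE pred_intros_countable measurable_C)
    have "space (tree_measure D) - Bad \<subseteq> Good"
    proof
      fix \<omega> assume w: "\<omega> \<in> space (tree_measure D) - Bad"
      have "radius D (C \<omega> q) \<le> R / s" if q: "real (length q) > ?L" for q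
      proof (rule ccontr)
        assume "\<not> radius D (C \<omega> q) \<le> R / s"
        then have large: "R / s < radius D (C \<omega> q)" by simp
        have "real (J * n) \<le> ?L"
          unfolding n_def by (rule level_count_bounds[OF s d J(2)]) (use m(2) in simp)
        with q have "J * n \<le> length q" by linarith
        from bad_descendant_witness[OF s J(1) d r r_le[unfolded R_def] K(3) _ this large[unfolded R_def]] w
        obtain i k k' q' where "i < J" "(k, k') \<in> P" "length q' = n + i * n" "\<omega> \<in> B k k' q'"
          unfolding P_def B_def by blast
        then have "(i, k, k') \<in> {..<J} \<times> P" "\<omega> \<in> U (i, k, k')" by (auto simp: U_def)
        then have "\<omega> \<in> Bad" unfolding Bad_def by blast
        with w show False by blast
      qed
      with w show "\<omega> \<in> Good" by (simp add: Good_def)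
    qed
    then have "prob (space (tree_measure D) - Bad) \<le> prob Good"
      using Good_sets by (rule finite_measure_mono)
    then show ?thesis
      using Bad_le prob_compl[OF Bad_sets] unfolding Good_def R_def by linarith
  qed
qed

end

theorem theorem2:
  shows "\<exists>c\<^sub>3::real. \<forall>(D::nat) (S::(nat \<Rightarrow> real) set) (pick::pick_rule)
      (\<omega>\<^sub>0::node \<Rightarrow> draw) (p::node) (d::nat) (s::real).
    0 < D \<longrightarrow> finite S \<longrightarrow> S \<subseteq> Rn D \<longrightarrow> valid_pick D S pick \<longrightarrow>
    \<omega>\<^sub>0 \<in> space (tree_measure D) \<longrightarrow>
    doubling_dim D (cell D S pick \<omega>\<^sub>0 p) \<le> d \<longrightarrow> 2 \<le> s \<longrightarrow>
    \<P>(\<omega> in tree_measure D.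
        \<forall>q. real (length q) > c\<^sub>3 * ln s * (real d * ln (s * real d)) \<longrightarrow>
          radius D (cell D S pick (resample p \<omega>\<^sub>0 \<omega>) (q @ p))
            \<le> radius D (cell D S pick \<omega>\<^sub>0 p) / s)
      \<ge> 1 - 1 / 4"
proof (intro exI[of _ 460800] allI impI)
  fix D S pick \<omega>\<^sub>0 p d and s :: real
  assume "0 < D" "finite S" "S \<subseteq> Rn D" "valid_pick D S pick" "\<omega>\<^sub>0 \<in> space (tree_measure D)"
    and dbl: "doubling_dim D (cell D S pick \<omega>\<^sub>0 p) \<le> d" and s: "2 \<le> s"
  then interpret rptree_below D S pick \<omega>\<^sub>0 p by unfold_locales
  show "\<P>(\<omega> in tree_measure D.
        \<forall>q. real (length q) > 460800 * ln s * (real d * ln (s * real d)) \<longrightarrow>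
          radius D (cell D S pick (resample p \<omega>\<^sub>0 \<omega>) (q @ p))
            \<le> radius D (cell D S pick \<omega>\<^sub>0 p) / s)
      \<ge> 1 - 1 / 4"
    using prob_descendants_small[OF dbl s] unfolding C_def .
qed

end
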